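(* Let $n,m,k$ be positive integers, let $X\in\mathbb{C}^{n\times n}$ be Hermitian, let $\Lambda:\mathbb{C}^{n\times n}\to\mathbb{C}^{m\times m}$ be a Hermitian-preserving linear map and $Y\in\mathbb{C}^{m\times m}$ Hermitian. Let $\xi$ be the optimal value of \[ \max_{\rho\in\mathbb{C}^{n\times n}}\ \operatorname{Tr}(X\rho)\quad\text{s.t.}\quad \Lambda(\rho)\le Y,\ \operatorname{Tr}(\rho)=1,\ \rho\ge 0,\ \operatorname{rank}(\rho)\le k . \] For a positive integer $N$, let $\mathcal{H}_A=\cdots=\mathcal{H}_Z=\mathbb{C}^n\otimes\mathbb{C}^k$ be $N$ copies (parties $A,\dots,Z$), $\widetilde{X}=X\otimes\mathbb{1}_k$, $\widetilde{\Lambda}(\cdot)=\Lambda[\operatorname{Tr}_2(\cdot)]$ with $\operatorname{Tr}_2$ the partial trace over $\mathbb{C}^k$, and let $\xi_N$ be the optimal value of the semidefinite program \[ \max_{\Phi_{AB\cdots Z}}\ \operatorname{Tr}\big[(\widetilde{X}_A\otimes\mathbb{1}_{B\cdots Z})\Phi_{AB\cdots Z}\big]\ \text{s.t.}\ \Phi_{AB\cdots Z}\ge0,\ \operatorname{Tr}(\Phi_{AB\cdots Z})=1,\ P_N^+\Phi_{AB\cdots Z}P_N^+=\Phi_{AB\cdots Z}, \] \[ (\widetilde{\Lambda}_A\otimes\mathrm{id}_{B\cdots Z})(\Phi_{AB\cdots Z})\le Y\otimes\operatorname{Tr}_A(\Phi_{AB\cdots Z}). \] Then $\xi\le\xi_N$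 for every $N$, $\xi_{N+1}\le\xi_N$ for all $N$, and $\lim_{N\to+\infty}\xi_N=\xi$.
   Context: $\le$ between Hermitian matrices is the Löwner order ($A\le B$ iff $B-A$ is positive semidefinite). A map is Hermitian-preserving if it maps Hermitian matrices to Hermitian matrices. $P_N^+=\frac{1}{N!}\sum_{\sigma\in S_N}V_\sigma$ is the orthogonal projector onto the symmetric subspace of $(\mathbb{C}^n\otimes\mathbb{C}^k)^{\otimes N}$, with $V_\sigma$ permuting the $N$ tensor factors. A subscript $A$ indicates action on the first party, $\mathrm{id}_{B\cdots Z}$ is the identity map on the remaining parties, and $\operatorname{Tr}_A$ is the partial trace over the first party. *)

theory Defs
  imports "Jordan_Normal_Form.DL_Rank" "HOL-Combinatorics.Permutations"
    "HOL-Library.Extended_Real"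
begin

definition mtrace :: "complex mat \<Rightarrow> complex" where
  "mtrace M = (\<Sum>i<dim_row M. M $$ (i, i))"

definition herm :: "complex mat \<Rightarrow> bool" where
  "herm M \<longleftrightarrow> dim_row M = dim_col M \<and>
     (\<forall>i<dim_row M. \<forall>j<dim_row M. M $$ (i, j) = cnj (M $$ (j, i)))"

definition psd :: "complex mat \<Rightarrow> bool" where
  "psd M \<longleftrightarrow> herm M \<and>
     (\<forall>v \<in> carrier_vec (dim_row M).
        0 \<le> Re (\<Sum>i<dim_row M. \<Sum>j<dim_row M. cnj (v $ i) * M $$ (i, j) * v $ j))"

definition loewner_le :: "complex mat \<Rightarrow> complex mat \<Rightarrow> bool" where
  "loewner_le A B \<longleftrightarrow> dim_row A = dim_row B \<and> dim_col A = dim_col B \<and> psd (B - A)"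

definition crank :: "complex mat \<Rightarrow> nat" where
  "crank M = vec_space.rank (dim_row M) M"

(* Kronecker (tensor) product, first factor = most significant index *)
definition kron :: "complex mat \<Rightarrow> complex mat \<Rightarrow> complex mat" where
  "kron A B = mat (dim_row A * dim_row B) (dim_col A * dim_col B)
     (\<lambda>(i, j). A $$ (i div dim_row B, j div dim_col B) * B $$ (i mod dim_row B, j mod dim_col B))"

definition ptrace_first :: "nat \<Rightarrow> nat \<Rightarrow> complex mat \<Rightarrow> complex mat" where
  "ptrace_first a b M = mat b b (\<lambda>(i, j). \<Sum>r<a. M $$ (r * b + i, r * b + j))"

definition ptrace_second :: "nat \<Rightarrow> nat \<Rightarrow> complex mat \<Rightarrow> complex mat" where
  "ptrace_second a b M = mat a a (\<lambda>(i, j). \<Sum>r<b. M $$ (i * b + r, j * b + r))"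

(* (L \<otimes> id)(M) for a linear map L : C^{a x a} \<rightarrow> C^{m x m}, M acting on C^a \<otimes> C^b:
   M = \<Sum>_{IJ} M_{IJ} \<otimes> |I><J|  \<mapsto>  \<Sum>_{IJ} L(M_{IJ}) \<otimes> |I><J| *)
definition apply_first ::
  "nat \<Rightarrow> nat \<Rightarrow> nat \<Rightarrow> (complex mat \<Rightarrow> complex mat) \<Rightarrow> complex mat \<Rightarrow> complex mat" where
  "apply_first m a b L M = mat (m * b) (m * b)
     (\<lambda>(I, J). L (mat a a (\<lambda>(r, s). M $$ (r * b + I mod b, s * b + J mod b))) $$ (I div b, J div b))"

(* l-th tensor factor digit (l = 0 is the first party A) of a basis index of (C^d)^{\<otimes>N} *)
definition digit :: "nat \<Rightarrow> nat \<Rightarrow> nat \<Rightarrow> nat \<Rightarrow> nat" where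
  "digit N d l i = (i div d ^ (N - 1 - l)) mod d"

definition perm_op :: "nat \<Rightarrow> nat \<Rightarrow> (nat \<Rightarrow> nat) \<Rightarrow> complex mat" where
  "perm_op N d \<sigma> = mat (d ^ N) (d ^ N)
     (\<lambda>(i, j). if (\<forall>l<N. digit N d l i = digit N d (\<sigma> l) j) then 1 else 0)"

definition sym_proj :: "nat \<Rightarrow> nat \<Rightarrow> complex mat" where
  "sym_proj N d = mat (d ^ N) (d ^ N)
     (\<lambda>(i, j). (\<Sum>\<sigma> \<in> {\<sigma>. \<sigma> permutes {..<N}}. perm_op N d \<sigma> $$ (i, j)) / of_nat (fact N))"

definition herm_preserving_linear ::
  "nat \<Rightarrow> nat \<Rightarrow> (complex mat \<Rightarrow> complex mat) \<Rightarrow> bool" where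
  "herm_preserving_linear n m L \<longleftrightarrow>
     (\<forall>A \<in> carrier_mat n n. L A \<in> carrier_mat m m) \<and>
     (\<forall>A \<in> carrier_mat n n. \<forall>B \<in> carrier_mat n n. L (A + B) = L A + L B) \<and>
     (\<forall>A \<in> carrier_mat n n. \<forall>c. L (c \<cdot>\<^sub>m A) = c \<cdot>\<^sub>m L A) \<and>
     (\<forall>A \<in> carrier_mat n n. herm A \<longrightarrow> herm (L A))"

(* optimal value of the rank-constrained problem (Sup of empty set = -\<infinity>) *)
definition xi ::
  "nat \<Rightarrow> nat \<Rightarrow> complex mat \<Rightarrow> (complex mat \<Rightarrow> complex mat) \<Rightarrow> complex mat \<Rightarrow> ereal" where
  "xi n k X L Y = Sup {ereal (Re (mtrace (X * \<rho>))) | \<rho>.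
      \<rho> \<in> carrier_mat n n \<and> loewner_le (L \<rho>) Y \<and> mtrace \<rho> = 1 \<and> psd \<rho> \<and> crank \<rho> \<le> k}"

definition xi_N ::
  "nat \<Rightarrow> nat \<Rightarrow> nat \<Rightarrow> complex mat \<Rightarrow> (complex mat \<Rightarrow> complex mat) \<Rightarrow> complex mat \<Rightarrow> nat \<Rightarrow> ereal" where
  "xi_N n m k X L Y N =
    (let d = n * k; b = d ^ (N - 1); P = sym_proj N d;
         Xt = kron X (1\<^sub>m k);
         Lt = (\<lambda>M. L (ptrace_second n k M))
     in Sup {ereal (Re (mtrace (kron Xt (1\<^sub>m b) * \<Phi>))) | \<Phi>.
           \<Phi> \<in> carrier_mat (d ^ N) (d ^ N) \<and> psd \<Phi> \<and> mtrace \<Phi> = 1 \<and> P * \<Phi> * P = \<Phi> \<and>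
           loewner_le (apply_first m d b Lt \<Phi>) (kron Y (ptrace_first d b \<Phi>))})"

end

theory Submission
  imports Defs "HOL-Analysis.Function_Metric"
begin

text \<open>
  Conditioning the last party of a feasible \<open>\<Phi>\<close> on a vector \<open>w\<close> yields, up to normalization, a
  point that is feasible for one party fewer; summing over an orthonormal basis gives the partial
  trace, hence monotonicity. For the limit, consider the one-party marginals \<open>\<sigma>\<close> that are
  limits of marginals of feasible points for every \<open>N\<close>. Among those of trace one with maximal objective
  value choose one that maximizes \<open>tr \<sigma>\<^sup>2\<close>. Some two-party limit \<open>\<Psi>\<close> extends \<open>\<sigma>\<close>, and conditioning
  \<open>\<Psi>\<close> on the vectors of a tight frame writes \<open>\<sigma>\<close> as a convex combination of limit marginals. They
  all have maximal value, so by strict convexity of \<open>tr \<sigma>\<^sup>2\<close> they all equal \<open>\<sigma>\<close>; polarization then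
  gives \<open>\<Psi> = q \<otimes> \<sigma>\<close>, and the permutation symmetry of \<open>\<Psi>\<close> forces \<open>\<sigma>\<close> to have rank one. Thus
  \<open>Tr\<^sub>2 \<sigma>\<close> is feasible for the rank-constrained problem. This replaces the quantum de Finetti theorem.
  Conversely, a feasible \<open>\<rho>\<close> of rank at most \<open>k\<close> has a purification \<open>\<phi>\<close> in \<open>\<complex>\<^sup>n \<otimes> \<complex>\<^sup>k\<close>, and the
  tensor powers of \<open>\<phi>\<phi>\<^sup>*\<close> are feasible for all \<open>N\<close>.
\<close>

section \<open>Sums over composite indices\<close>

lemma sum_lessThan_mult:
  fixes f :: "nat \<Rightarrow> 'a::comm_monoid_add"
  shows "(\<Sum>i<a * b. f i) = (\<Sum>i<a. \<Sum>j<b. f (i * b + j))"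
proof -
  have "(\<Sum>j<b. f (i * b + j)) = sum f {i * b..<i * b + b}" for i
    using sum.shift_bounds_nat_ivl[of f 0 "i * b" b]
    by (simp add: atLeast0LessThan add.commute)
  then show ?thesis
    using sum.nat_group[of f b a] by simp
qed

lemma mult_add_less_mult: "i < a \<Longrightarrow> r < b \<Longrightarrow> i * b + r < a * (b::nat)"
proof -
  assume "i < a" "r < b"
  then have "i * b + r < Suc i * b" by simp
  also have "\<dots> \<le> a * b" using \<open>i < a\<close> by (intro mult_right_mono) auto
  finally show ?thesis .
qed

subsection \<open>Positive semidefinite kernels\<close>

text \<open>Matrices are handled as kernels \<open>nat \<Rightarrow> nat \<Rightarrow> complex\<close>, which carry the product topology;
  the dimension is an argument of each notion.\<close>

type_synonym kernel = "nat \<Rightarrow> nat \<Rightarrow> complex"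

definition psd_kernel :: "nat \<Rightarrow> kernel \<Rightarrow> bool" where
  "psd_kernel D F \<longleftrightarrow> (\<forall>i<D. \<forall>j<D. F i j = cnj (F j i)) \<and>
     (\<forall>v. 0 \<le> Re (\<Sum>i<D. \<Sum>j<D. cnj (v i) * F i j * v j))"

lemma psd_kernel_herm: "psd_kernel D F \<Longrightarrow> i < D \<Longrightarrow> j < D \<Longrightarrow> F i j = cnj (F j i)"
  unfolding psd_kernel_def by blast

lemma psd_kernel_nonneg: "psd_kernel D F \<Longrightarrow> 0 \<le> Re (\<Sum>i<D. \<Sum>j<D. cnj (v i) * F i j * v j)"
  unfolding psd_kernel_def by blast

text \<open>Forcing zeros outside the block makes a kernel a canonical representative of its matrix.
  Equality of kernels is then equality of functions, and a bound on the block bounds all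
  entries.\<close>

definition supported :: "nat \<Rightarrow> kernel \<Rightarrow> bool" where
  "supported D F \<longleftrightarrow> (\<forall>i j. \<not> (i < D \<and> j < D) \<longrightarrow> F i j = 0)"

definition ktrace :: "nat \<Rightarrow> kernel \<Rightarrow> complex" where
  "ktrace D F = (\<Sum>i<D. F i i)"

text \<open>The unnormalized state of the other parties after the last one has been projected onto
  \<open>w\<close>: the compression of \<open>F\<close> by identity tensor \<open>w\<close>.\<close>

definition condition_last :: "nat \<Rightarrow> (nat \<Rightarrow> complex) \<Rightarrow> kernel \<Rightarrow> kernel" where
  "condition_last d w F = (\<lambda>i j. \<Sum>r<d. \<Sum>s<d. cnj (w r) * F (i * d + r) (j * d + s) * w s)"

definition trace_last :: "nat \<Rightarrow> kernel \<Rightarrow> kernel" where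
  "trace_last d F = (\<lambda>i j. \<Sum>r<d. F (i * d + r) (j * d + r))"

text \<open>Conditioning on the standard basis: closure properties of sums and of
  \<open>condition_last\<close> thereby pass to the partial trace.\<close>

lemma trace_last_eq_sum_condition:
  "trace_last d F i j = (\<Sum>t<d. condition_last d (\<lambda>r. if r = t then 1 else 0) F i j)"
proof -
  have "condition_last d (\<lambda>r. if r = t then 1 else 0) F i j = F (i * d + t) (j * d + t)"
    if "t < d" for t
  proof -
    have "condition_last d (\<lambda>r. if r = t then 1 else 0) F i j
        = (\<Sum>r<d. \<Sum>s<d. if s = t then (if r = t then F (i * d + r) (j * d + s) else 0) else 0)"
      unfolding condition_last_def by (intro sum.cong refl) auto
    then show ?thesis using that by simp
  qed
  then show ?thesis by (simp add: trace_last_def)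
qed

lemma ktrace_trace_last: "ktrace D (trace_last d F) = ktrace (D * d) F"
  by (simp add: ktrace_def trace_last_def sum_lessThan_mult)

lemma psd_kernel_cong:
  assumes "\<And>i j. i < D \<Longrightarrow> j < D \<Longrightarrow> F i j = G i j"
  shows "psd_kernel D F \<longleftrightarrow> psd_kernel D G"
  using assms by (simp add: psd_kernel_def)

lemma psd_kernel_zero: "psd_kernel D (\<lambda>_ _. 0)"
  by (simp add: psd_kernel_def)

lemma psd_kernel_add:
  assumes "psd_kernel D F" "psd_kernel D G"
  shows "psd_kernel D (\<lambda>i j. F i j + G i j)"
  unfolding psd_kernel_def
proof (intro conjI allI impI)
  show "F i j + G i j = cnj (F j i + G j i)" if "i < D" "j < D" for i j
    using psd_kernel_herm[OF assms(1) that] psd_kernel_herm[OF assms(2) that] by simp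
  show "0 \<le> Re (\<Sum>i<D. \<Sum>j<D. cnj (v i) * (F i j + G i j) * v j)" for v
    using psd_kernel_nonneg[OF assms(1), of v] psd_kernel_nonneg[OF assms(2), of v]
    by (simp only: distrib_left distrib_right sum.distrib plus_complex.sel)
qed

lemma psd_kernel_sum:
  assumes "finite A" "\<And>t. t \<in> A \<Longrightarrow> psd_kernel D (F t)"
  shows "psd_kernel D (\<lambda>i j. \<Sum>t\<in>A. F t i j)"
  using assms
proof (induction A rule: finite_induct)
  case (insert t A)
  then show ?case using psd_kernel_add[of D "F t" "\<lambda>i j. \<Sum>t\<in>A. F t i j"] by simp
qed (simp add: psd_kernel_zero)

lemma psd_kernel_scale:
  assumes "psd_kernel D F" "0 \<le> (c::real)"
  shows "psd_kernel D (\<lambda>i j. of_real c * F i j)"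
  unfolding psd_kernel_def
proof (intro conjI allI impI)
  show "of_real c * F i j = cnj (of_real c * F j i)" if "i < D" "j < D" for i j
    using psd_kernel_herm[OF assms(1) that] by simp
  fix v
  have "(\<Sum>i<D. \<Sum>j<D. cnj (v i) * (of_real c * F i j) * v j)
     = of_real c * (\<Sum>i<D. \<Sum>j<D. cnj (v i) * F i j * v j)"
    by (simp only: sum_distrib_left mult_ac)
  then show "0 \<le> Re (\<Sum>i<D. \<Sum>j<D. cnj (v i) * (of_real c * F i j) * v j)"
    using mult_nonneg_nonneg[OF assms(2) psd_kernel_nonneg[OF assms(1), of v]]
    by (simp only: times_complex.sel Re_complex_of_real Im_complex_of_real mult_zero_left diff_zero)
qed

lemma psd_kernel_condition_last:
  assumes "psd_kernel (D * d) F"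
  shows "psd_kernel D (condition_last d w F)"
proof -
  have h: "F i j = cnj (F j i)" if "i < D * d" "j < D * d" for i j
    using psd_kernel_herm[OF assms that] .
  have "condition_last d w F i j = cnj (condition_last d w F j i)" if ij: "i < D" "j < D" for i j
  proof -
    have "cnj (condition_last d w F j i)
        = (\<Sum>r<d. \<Sum>s<d. cnj (w s) * cnj (F (j * d + r) (i * d + s)) * w r)"
      by (simp add: condition_last_def mult_ac)
    also have "\<dots> = (\<Sum>r<d. \<Sum>s<d. cnj (w s) * F (i * d + s) (j * d + r) * w r)"
      by (intro sum.cong refl)
         (use ij in \<open>simp add: h[symmetric] mult_add_less_mult\<close>)
    also have "\<dots> = condition_last d w F i j"
      unfolding condition_last_def by (rule sum.swap)
    finally show ?thesis by simp
  qed
  moreover have "0 \<le> Re (\<Sum>i<D. \<Sum>j<D. cnj (v i) * condition_last d w F i j * v j)" for v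
  proof -
    \<comment> \<open>On the product vector of \<open>v\<close> and \<open>w\<close> the form of
      \<open>F\<close> takes the value of the conditioned form at \<open>v\<close>.\<close>
    let ?u = "\<lambda>I. v (I div d) * w (I mod d)"
    have "(\<Sum>I<D * d. \<Sum>J<D * d. cnj (?u I) * F I J * ?u J)
       = (\<Sum>i<D. \<Sum>r<d. \<Sum>j<D. \<Sum>s<d.
            cnj (v i * w r) * F (i * d + r) (j * d + s) * (v j * w s))"
      unfolding sum_lessThan_mult by (intro sum.cong refl) simp
    also have "\<dots> = (\<Sum>i<D. \<Sum>j<D. \<Sum>r<d. \<Sum>s<d.
            cnj (v i * w r) * F (i * d + r) (j * d + s) * (v j * w s))"
      by (intro sum.cong refl sum.swap)
    also have "\<dots> = (\<Sum>i<D. \<Sum>j<D. cnj (v i) * condition_last d w F i j * v j)"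
      unfolding condition_last_def sum_distrib_left sum_distrib_right
      by (intro sum.cong refl) (simp add: mult_ac)
    finally show ?thesis using psd_kernel_nonneg[OF assms, of ?u] by (simp only:)
  qed
  ultimately show ?thesis unfolding psd_kernel_def by blast
qed

lemma psd_kernel_trace_last:
  assumes "psd_kernel (D * d) F"
  shows "psd_kernel D (trace_last d F)"
proof -
  have "psd_kernel D (\<lambda>i j. \<Sum>t<d. condition_last d (\<lambda>r. if r = t then 1 else 0) F i j)"
    by (intro psd_kernel_sum psd_kernel_condition_last assms) auto
  then show ?thesis by (simp flip: trace_last_eq_sum_condition)
qed

lemma psd_kernel_diag:
  assumes "psd_kernel D F" "i < D"
  shows "F i i = of_real (Re (F i i))" "0 \<le> Re (F i i)"
proof -
  have "F i i = cnj (F i i)" using psd_kernel_herm[OF assms(1,2,2)] .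
  then show "F i i = of_real (Re (F i i))" by (simp add: complex_eq_iff)
  let ?v = "\<lambda>r. if r = i then 1 else (0::complex)"
  have "(\<Sum>r<D. \<Sum>s<D. cnj (?v r) * F r s * ?v s)
      = (\<Sum>r<D. \<Sum>s<D. if s = i then (if r = i then F r s else 0) else 0)"
    by (intro sum.cong refl) auto
  also have "\<dots> = F i i" using assms(2) by simp
  finally show "0 \<le> Re (F i i)" using psd_kernel_nonneg[OF assms(1), of ?v] by (simp only:)
qed

lemma psd_kernel_trace:
  assumes "psd_kernel D F"
  shows "ktrace D F = of_real (Re (ktrace D F))" "0 \<le> Re (ktrace D F)"
    and "i < D \<Longrightarrow> Re (F i i) \<le> Re (ktrace D F)"
proof -
  have "ktrace D F = (\<Sum>i<D. of_real (Re (F i i)))"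
    unfolding ktrace_def using psd_kernel_diag(1)[OF assms] by (intro sum.cong) auto
  then show "ktrace D F = of_real (Re (ktrace D F))" by simp
  show "0 \<le> Re (ktrace D F)"
    unfolding ktrace_def Re_sum using psd_kernel_diag(2)[OF assms] by (intro sum_nonneg) auto
  show "Re (F i i) \<le> Re (ktrace D F)" if "i < D"
    unfolding ktrace_def Re_sum using psd_kernel_diag(2)[OF assms] that
    by (intro member_le_sum[of i _ "\<lambda>i. Re (F i i)"]) auto
qed

lemma psd_kernel_two_point:
  assumes "psd_kernel D F" "i < D" "j < D" "i \<noteq> j"
  shows "0 \<le> Re (F i i + z * F i j + cnj z * F j i + cnj z * z * F j j)"
proof -
  let ?v = "\<lambda>r. if r = i then 1 else if r = j then z else 0"
  have inner: "(\<Sum>s<D. cnj (?v r) * F r s * ?v s) = cnj (?v r) * (F r i + F r j * z)" for r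
  proof -
    have "(\<Sum>s<D. cnj (?v r) * F r s * ?v s)
       = (\<Sum>s<D. (if s = i then cnj (?v r) * F r s else 0) + (if s = j then cnj (?v r) * F r s * z else 0))"
      using assms(4) by (intro sum.cong refl) auto
    then show ?thesis using assms by (simp add: sum.distrib algebra_simps)
  qed
  have "(\<Sum>r<D. \<Sum>s<D. cnj (?v r) * F r s * ?v s)
      = (\<Sum>r<D. (if r = i then F r i + F r j * z else 0) + (if r = j then cnj z * (F r i + F r j * z) else 0))"
    unfolding inner using assms(4) by (intro sum.cong refl) auto
  also have "\<dots> = F i i + z * F i j + cnj z * F j i + cnj z * z * F j j"
    using assms by (simp add: sum.distrib algebra_simps)
  finally show ?thesis using psd_kernel_nonneg[OF assms(1), of ?v] by (simp only:)
qed

text \<open>This bound turns a bound on the trace into compactness. The constant 2 is crude: the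
  real and the imaginary part are estimated separately.\<close>

lemma psd_kernel_norm_le_trace:
  assumes "psd_kernel D F" "i < D" "j < D"
  shows "cmod (F i j) \<le> 2 * Re (ktrace D F)"
proof (cases "i = j")
  case True
  then have "cmod (F i j) = Re (F i i)"
    using psd_kernel_diag[OF assms(1,2)] by (metis norm_of_real abs_of_nonneg)
  then show ?thesis using psd_kernel_trace(2,3)[OF assms(1)] assms(2) by fastforce
next
  case False
  have h: "F j i = cnj (F i j)" using psd_kernel_herm[OF assms(1,3,2)] .
  \<comment> \<open>The values 1, -1, \<i>, -\<i> of \<open>z\<close> bound the real and imaginary
    parts of \<open>F i j\<close> from both sides.\<close>
  have *: "0 \<le> Re (F i i) + Re (F j j) + 2 * Re (z * F i j)" if "cnj z * z = 1" for z
    using psd_kernel_two_point[OF assms False, of z] unfolding that h by simp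
  have "0 \<le> Re (F i i) + Re (F j j) + 2 * Re (F i j)" "0 \<le> Re (F i i) + Re (F j j) - 2 * Re (F i j)"
    "0 \<le> Re (F i i) + Re (F j j) + 2 * Im (F i j)" "0 \<le> Re (F i i) + Re (F j j) - 2 * Im (F i j)"
    using *[of 1] *[of "-1"] *[of "\<i>"] *[of "-\<i>"] by simp_all
  then have "\<bar>Re (F i j)\<bar> + \<bar>Im (F i j)\<bar> \<le> Re (F i i) + Re (F j j)" by linarith
  also have "\<dots> \<le> 2 * Re (ktrace D F)"
    using psd_kernel_trace(3)[OF assms(1,2)] psd_kernel_trace(3)[OF assms(1,3)] by linarith
  finally show ?thesis using cmod_le[of "F i j"] by linarith
qed

lemma sum_swap_pairs:
  "(\<Sum>a\<in>A. \<Sum>b\<in>B. \<Sum>c\<in>C. \<Sum>e\<in>E. f a b c e) = (\<Sum>c\<in>C. \<Sum>e\<in>E. \<Sum>a\<in>A. \<Sum>b\<in>B. f a b c e)"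
proof -
  have "(\<Sum>a\<in>A. \<Sum>b\<in>B. \<Sum>c\<in>C. \<Sum>e\<in>E. f a b c e) = (\<Sum>a\<in>A. \<Sum>c\<in>C. \<Sum>b\<in>B. \<Sum>e\<in>E. f a b c e)"
    by (rule sum.cong[OF refl], rule sum.swap)
  also have "\<dots> = (\<Sum>c\<in>C. \<Sum>a\<in>A. \<Sum>b\<in>B. \<Sum>e\<in>E. f a b c e)" by (rule sum.swap)
  also have "\<dots> = (\<Sum>c\<in>C. \<Sum>a\<in>A. \<Sum>e\<in>E. \<Sum>b\<in>B. f a b c e)"
    by (rule sum.cong[OF refl], rule sum.cong[OF refl], rule sum.swap)
  also have "\<dots> = (\<Sum>c\<in>C. \<Sum>e\<in>E. \<Sum>a\<in>A. \<Sum>b\<in>B. f a b c e)"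
    by (rule sum.cong[OF refl], rule sum.swap)
  finally show ?thesis .
qed

subsection \<open>Permutation of tensor factors\<close>

text \<open>The first party is the most significant digit, so appending a last party with basis
  index \<open>r\<close> sends \<open>i\<close> to \<open>i * d + r\<close>.\<close>

lemma digit_Suc_last:
  assumes "0 < d" "r < d"
  shows "l < N \<Longrightarrow> digit (Suc N) d l (i * d + r) = digit N d l i"
    and "digit (Suc N) d N (i * d + r) = r"
proof -
  assume "l < N"
  then have "Suc N - 1 - l = Suc (N - 1 - l)" by simp
  then have "(i * d + r) div d ^ (Suc N - 1 - l) = i div d ^ (N - 1 - l)"
    using assms by (simp add: div_mult2_eq)
  then show "digit (Suc N) d l (i * d + r) = digit N d l i" by (simp add: digit_def)
qed (use assms in \<open>simp add: digit_def\<close>)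

definition same_up_to_perm :: "nat \<Rightarrow> nat \<Rightarrow> nat \<Rightarrow> nat \<Rightarrow> bool" where
  "same_up_to_perm N d i j \<longleftrightarrow>
     (\<exists>\<sigma>. \<sigma> permutes {..<N} \<and> (\<forall>l<N. digit N d l i = digit N d (\<sigma> l) j))"

text \<open>Rows and columns may be permuted independently. This is support on the symmetric
  subspace, stronger than invariance under simultaneous permutation of both indices; the rank-one
  conclusion rests on the difference.\<close>

definition symmetric_kernel :: "nat \<Rightarrow> nat \<Rightarrow> kernel \<Rightarrow> bool" where
  "symmetric_kernel N d F \<longleftrightarrow> (\<forall>i<d ^ N. \<forall>i'<d ^ N. \<forall>j<d ^ N. \<forall>j'<d ^ N.
     same_up_to_perm N d i i' \<longrightarrow> same_up_to_perm N d j j' \<longrightarrow> F i j = F i' j')"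

lemma same_up_to_perm_refl: "same_up_to_perm N d i i"
  unfolding same_up_to_perm_def by (rule exI[of _ id]) (auto simp: permutes_id)

lemma same_up_to_perm_append_last:
  assumes "0 < d" "r < d" "same_up_to_perm N d i j"
  shows "same_up_to_perm (Suc N) d (i * d + r) (j * d + r)"
proof -
  obtain \<sigma> where s: "\<sigma> permutes {..<N}" "\<forall>l<N. digit N d l i = digit N d (\<sigma> l) j"
    using assms(3) unfolding same_up_to_perm_def by blast
  have "\<sigma> permutes {..<Suc N}" by (rule permutes_subset[OF s(1)]) auto
  moreover have "digit (Suc N) d l (i * d + r) = digit (Suc N) d (\<sigma> l) (j * d + r)" if "l < Suc N" for l
  proof (cases "l = N")
    case True
    then have "\<sigma> l = N" using permutes_not_in[OF s(1), of N] by simp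
    then show ?thesis using True assms by (simp add: digit_Suc_last)
  next
    case False
    then have "l < N" using that by simp
    moreover have "\<sigma> l < N" using permutes_in_image[OF s(1), of l] \<open>l < N\<close> by simp
    ultimately show ?thesis using s(2) assms by (simp add: digit_Suc_last)
  qed
  ultimately show ?thesis unfolding same_up_to_perm_def by blast
qed

lemma same_up_to_perm_swap_last:
  assumes "0 < d" "r < d" "s < d"
  shows "same_up_to_perm (Suc (Suc N)) d ((i * d + r) * d + s) ((i * d + s) * d + r)"
proof -
  let ?\<sigma> = "transpose N (Suc N)"
  have "?\<sigma> permutes {..<Suc (Suc N)}" by (rule permutes_swap_id) auto
  moreover have "digit (Suc (Suc N)) d l ((i * d + r) * d + s)
      = digit (Suc (Suc N)) d (?\<sigma> l) ((i * d + s) * d + r)" if l: "l < Suc (Suc N)" for l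
  proof -
    consider "l < N" | "l = N" | "l = Suc N" using l by linarith
    then show ?thesis by cases (use assms in \<open>auto simp: digit_Suc_last\<close>)
  qed
  ultimately show ?thesis unfolding same_up_to_perm_def by blast
qed

lemma symmetric_kernelD:
  assumes "symmetric_kernel N d F" "same_up_to_perm N d i i'" "same_up_to_perm N d j j'"
    "i < d ^ N" "i' < d ^ N" "j < d ^ N" "j' < d ^ N"
  shows "F i j = F i' j'"
  using assms unfolding symmetric_kernel_def by blast

lemma symmetric_kernel_condition_last:
  assumes "0 < d" "symmetric_kernel (Suc N) d F"
  shows "symmetric_kernel N d (condition_last d w F)"
  unfolding symmetric_kernel_def
proof (intro allI impI)
  fix i i' j j'
  assume *: "i < d ^ N" "i' < d ^ N" "j < d ^ N" "j' < d ^ N"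
    "same_up_to_perm N d i i'" "same_up_to_perm N d j j'"
  have lt: "x * d + r < d ^ Suc N" if "x < d ^ N" "r < d" for x r
    using mult_add_less_mult[OF that] by (simp add: mult.commute)
  have "F (i * d + r) (j * d + s) = F (i' * d + r) (j' * d + s)" if "r < d" "s < d" for r s
    by (intro symmetric_kernelD[OF assms(2)] same_up_to_perm_append_last lt * that assms(1))
  then show "condition_last d w F i j = condition_last d w F i' j'"
    unfolding condition_last_def by (intro sum.cong refl) simp
qed

text \<open>The left side conditions the last party and traces the one before it, the right side
  does the opposite. Swapping these two parties in both indices exchanges the roles.\<close>

lemma trace_condition_last_commute:
  assumes "0 < d" "symmetric_kernel (Suc (Suc N)) d F" "i < d ^ N" "j < d ^ N"
  shows "trace_last d (condition_last d w F) i j = condition_last d w (trace_last d F) i j"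
proof -
  have lt: "(x * d + r) * d + s < d ^ Suc (Suc N)" if "x < d ^ N" "r < d" "s < d" for x r s
    using mult_add_less_mult[OF mult_add_less_mult[OF that(1,2)] that(3)]
    by (simp add: mult_ac)
  have sw: "F ((i * d + t) * d + r) ((j * d + t) * d + s) = F ((i * d + r) * d + t) ((j * d + s) * d + t)"
    if "t < d" "r < d" "s < d" for t r s
    by (intro symmetric_kernelD[OF assms(2)] same_up_to_perm_swap_last lt that assms(1,3,4))
  have "trace_last d (condition_last d w F) i j
     = (\<Sum>t<d. \<Sum>r<d. \<Sum>s<d. cnj (w r) * F ((i * d + r) * d + t) ((j * d + s) * d + t) * w s)"
    unfolding trace_last_def condition_last_def by (intro sum.cong refl arg_cong2[where f = "(*)"] sw) auto
  also have "\<dots> = (\<Sum>r<d. \<Sum>t<d. \<Sum>s<d. cnj (w r) * F ((i * d + r) * d + t) ((j * d + s) * d + t) * w s)"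
    by (rule sum.swap)
  also have "\<dots> = (\<Sum>r<d. \<Sum>s<d. \<Sum>t<d. cnj (w r) * F ((i * d + r) * d + t) ((j * d + s) * d + t) * w s)"
    by (intro sum.cong refl sum.swap)
  also have "\<dots> = condition_last d w (trace_last d F) i j"
    unfolding trace_last_def condition_last_def
    by (simp add: sum_distrib_left sum_distrib_right)
  finally show ?thesis .
qed

lemma symmetric_kernel_sum:
  assumes "\<And>t. t \<in> A \<Longrightarrow> symmetric_kernel N d (F t)"
  shows "symmetric_kernel N d (\<lambda>i j. \<Sum>t\<in>A. F t i j)"
  unfolding symmetric_kernel_def
proof (intro allI impI)
  fix i i' j j'
  assume *: "i < d ^ N" "i' < d ^ N" "j < d ^ N" "j' < d ^ N"
    "same_up_to_perm N d i i'" "same_up_to_perm N d j j'"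
  show "(\<Sum>t\<in>A. F t i j) = (\<Sum>t\<in>A. F t i' j')"
    by (intro sum.cong refl symmetric_kernelD[OF assms]) (use * in auto)
qed

subsection \<open>The cones of feasible kernels\<close>

text \<open>\<open>G a c r s\<close> is the coefficient of \<open>\<rho> r s\<close> in the \<open>(a, c)\<close> entry of \<open>Y tr \<rho> - \<Lambda>(Tr\<^sub>2 \<rho>)\<close>.
  Kernels in \<open>feasible M\<close> live on \<open>M + 1\<close> parties, so that the block of the first one is
  \<open>d ^ M\<close>.\<close>

locale sym_hierarchy =
  fixes d m :: nat and G :: "nat \<Rightarrow> nat \<Rightarrow> nat \<Rightarrow> nat \<Rightarrow> complex"
  assumes d_pos: "0 < d"
begin

text \<open>In an index \<open>I\<close> of the output, \<open>I div b\<close> belongs to the image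
  of the map on the first party and \<open>I mod b\<close> to the remaining parties, on which
  nothing acts.\<close>

definition constraint :: "nat \<Rightarrow> kernel \<Rightarrow> kernel" where
  "constraint b F = (\<lambda>I J. \<Sum>r<d. \<Sum>s<d.
     G (I div b) (J div b) r s * F (r * b + I mod b) (s * b + J mod b))"

text \<open>The trace is left free, which makes the set a cone: sums and conditioned kernels stay
  inside without normalization.\<close>

definition feasible :: "nat \<Rightarrow> kernel set" where
  "feasible M = {F. supported (d ^ Suc M) F \<and> psd_kernel (d ^ Suc M) F \<and>
     symmetric_kernel (Suc M) d F \<and> psd_kernel (m * d ^ M) (constraint (d ^ M) F)}"

lemma feasibleI:
  assumes "supported (d ^ Suc M) F" "psd_kernel (d ^ Suc M) F"
    "symmetric_kernel (Suc M) d F" "psd_kernel (m * d ^ M) (constraint (d ^ M) F)"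
  shows "F \<in> feasible M"
  using assms unfolding feasible_def by blast

lemma feasibleD:
  assumes "F \<in> feasible M"
  shows "supported (d ^ Suc M) F" "psd_kernel (d ^ Suc M) F"
    "symmetric_kernel (Suc M) d F" "psd_kernel (m * d ^ M) (constraint (d ^ M) F)"
  using assms unfolding feasible_def by blast+

lemma constraint_sum:
  "constraint b (\<lambda>i j. \<Sum>t\<in>A. F t i j) = (\<lambda>I J. \<Sum>t\<in>A. constraint b (F t) I J)"
proof (intro ext)
  fix I J
  show "constraint b (\<lambda>i j. \<Sum>t\<in>A. F t i j) I J = (\<Sum>t\<in>A. constraint b (F t) I J)"
    unfolding constraint_def sum_distrib_left
    by (simp only: sum.swap[of _ A])
qed

lemma constraint_scale:
  "constraint b (\<lambda>i j. c * F i j) = (\<lambda>I J. c * constraint b F I J)"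
  unfolding constraint_def by (simp add: sum_distrib_left mult_ac)

text \<open>The constraint acts on the first party and conditioning on the last one, so they
  commute; the work lies in splitting the last digit off the composite indices.\<close>

lemma constraint_condition_last:
  assumes "0 < b"
  shows "constraint b (condition_last d w F) I J = condition_last d w (constraint (b * d) F) I J"
proof -
  have dv: "(I * d + r) div (b * d) = I div b" if "r < d" for I r
    using that d_pos by (simp add: div_mult2_eq mult.commute[of b d])
  have ix: "t * (b * d) + (I * d + r) mod (b * d) = (t * b + I mod b) * d + r" if "r < d" for t I r
  proof -
    have "(I * d + r) mod (d * b) = d * (I mod b) + r"
      using that d_pos by (simp only: mod_mult2_eq) simp
    then show ?thesis by (simp add: algebra_simps)
  qed
  have "condition_last d w (constraint (b * d) F) I J
     = (\<Sum>r'<d. \<Sum>s'<d. \<Sum>r<d. \<Sum>s<d. cnj (w r') * (G (I div b) (J div b) r s *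
          F ((r * b + I mod b) * d + r') ((s * b + J mod b) * d + s')) * w s')"
    unfolding condition_last_def constraint_def sum_distrib_left sum_distrib_right
    by (intro sum.cong refl) (simp add: dv ix)
  also have "\<dots> = (\<Sum>r<d. \<Sum>s<d. \<Sum>r'<d. \<Sum>s'<d. cnj (w r') * (G (I div b) (J div b) r s *
          F ((r * b + I mod b) * d + r') ((s * b + J mod b) * d + s')) * w s')"
    by (rule sum_swap_pairs)
  also have "\<dots> = constraint b (condition_last d w F) I J"
    unfolding condition_last_def constraint_def sum_distrib_left sum_distrib_right
    by (intro sum.cong refl) (simp add: mult_ac)
  finally show ?thesis by simp
qed

lemma feasible_sum:
  assumes "finite A" "\<And>t. t \<in> A \<Longrightarrow> F t \<in> feasible M"
  shows "(\<lambda>i j. \<Sum>t\<in>A. F t i j) \<in> feasible M"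
proof (rule feasibleI)
  show "supported (d ^ Suc M) (\<lambda>i j. \<Sum>t\<in>A. F t i j)"
    using feasibleD(1)[OF assms(2)] unfolding supported_def by (auto intro!: sum.neutral)
  show "psd_kernel (d ^ Suc M) (\<lambda>i j. \<Sum>t\<in>A. F t i j)"
    by (intro psd_kernel_sum assms(1) feasibleD(2) assms(2))
  show "symmetric_kernel (Suc M) d (\<lambda>i j. \<Sum>t\<in>A. F t i j)"
    by (intro symmetric_kernel_sum feasibleD(3) assms(2))
  show "psd_kernel (m * d ^ M) (constraint (d ^ M) (\<lambda>i j. \<Sum>t\<in>A. F t i j))"
    unfolding constraint_sum by (intro psd_kernel_sum assms(1) feasibleD(4) assms(2))
qed

lemma feasible_scale:
  assumes "F \<in> feasible M" "0 \<le> (c::real)"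
  shows "(\<lambda>i j. of_real c * F i j) \<in> feasible M"
proof (rule feasibleI)
  show "supported (d ^ Suc M) (\<lambda>i j. of_real c * F i j)"
    using feasibleD(1)[OF assms(1)] unfolding supported_def by auto
  show "psd_kernel (d ^ Suc M) (\<lambda>i j. of_real c * F i j)"
    by (intro psd_kernel_scale feasibleD(2) assms)
  show "symmetric_kernel (Suc M) d (\<lambda>i j. of_real c * F i j)"
    using feasibleD(3)[OF assms(1)] unfolding symmetric_kernel_def by metis
  show "psd_kernel (m * d ^ M) (constraint (d ^ M) (\<lambda>i j. of_real c * F i j))"
    unfolding constraint_scale by (intro psd_kernel_scale feasibleD(4) assms)
qed

text \<open>Every defining condition survives: positivity by product test vectors, symmetry by
  permutations that fix the last party, and the constraint because it commutes with
  conditioning.\<close>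

lemma feasible_condition_last:
  assumes "F \<in> feasible (Suc M)"
  shows "condition_last d w F \<in> feasible M"
proof (rule feasibleI)
  show "supported (d ^ Suc M) (condition_last d w F)"
    unfolding supported_def
  proof (intro allI impI)
    fix i j assume *: "\<not> (i < d ^ Suc M \<and> j < d ^ Suc M)"
    have ge: "d ^ Suc (Suc M) \<le> x * d + r" if "d ^ Suc M \<le> x" for x r
      using mult_right_mono[OF that, of d] power_Suc2[of d "Suc M"] by linarith
    have "F (i * d + r) (j * d + s) = 0" for r s
      using feasibleD(1)[OF assms] * ge unfolding supported_def not_less[symmetric] by blast
    then show "condition_last d w F i j = 0" by (simp add: condition_last_def)
  qed
  show "psd_kernel (d ^ Suc M) (condition_last d w F)"
    using feasibleD(2)[OF assms] by (intro psd_kernel_condition_last) (simp add: mult_ac)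
  show "symmetric_kernel (Suc M) d (condition_last d w F)"
    using feasibleD(3)[OF assms] d_pos by (intro symmetric_kernel_condition_last)
  have "psd_kernel (m * d ^ M) (condition_last d w (constraint (d ^ M * d) F))"
    using feasibleD(4)[OF assms] by (intro psd_kernel_condition_last) (simp add: mult_ac)
  moreover have "constraint (d ^ M) (condition_last d w F) = condition_last d w (constraint (d ^ M * d) F)"
    by (intro ext constraint_condition_last) (simp add: d_pos)
  ultimately show "psd_kernel (m * d ^ M) (constraint (d ^ M) (condition_last d w F))"
    by (simp only:)
qed

lemma feasible_trace_last:
  assumes "F \<in> feasible (Suc M)"
  shows "trace_last d F \<in> feasible M"
proof -
  have "trace_last d F = (\<lambda>i j. \<Sum>t<d. condition_last d (\<lambda>r. if r = t then 1 else 0) F i j)"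
    by (intro ext trace_last_eq_sum_condition)
  then show ?thesis by (simp add: feasible_sum feasible_condition_last assms)
qed

lemma feasible_trace_last_funpow:
  "F \<in> feasible (k + M) \<Longrightarrow> (trace_last d ^^ k) F \<in> feasible M"
  by (induction k arbitrary: F) (auto simp: funpow_Suc_right feasible_trace_last simp del: funpow.simps)

lemma trace_condition_last_feasible:
  assumes "F \<in> feasible (Suc (Suc M))"
  shows "trace_last d (condition_last d w F) = condition_last d w (trace_last d F)"
proof (intro ext)
  fix i j
  show "trace_last d (condition_last d w F) i j = condition_last d w (trace_last d F) i j"
  proof (cases "i < d ^ Suc M \<and> j < d ^ Suc M")
    case True
    then show ?thesis
      using trace_condition_last_commute[OF d_pos feasibleD(3)[OF assms]] by blast
  next
    case False
    have "trace_last d (condition_last d w F) i j = 0"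
      using feasibleD(1)[OF feasible_trace_last[OF feasible_condition_last[OF assms]]] False
      unfolding supported_def by blast
    moreover have "condition_last d w (trace_last d F) i j = 0"
      using feasibleD(1)[OF feasible_condition_last[OF feasible_trace_last[OF assms]]] False
      unfolding supported_def by blast
    ultimately show ?thesis by simp
  qed
qed

text \<open>Conditioning the two-party marginal of \<open>F\<close> on \<open>w\<close> therefore
  yields a one-party marginal of a feasible kernel with one party fewer than
  \<open>F\<close>.\<close>

lemma trace_condition_last_funpow:
  "F \<in> feasible (Suc M) \<Longrightarrow>
    (trace_last d ^^ M) (condition_last d w F) = condition_last d w ((trace_last d ^^ M) F)"
proof (induction M arbitrary: F)
  case (Suc M)
  then show ?case
    using Suc.IH[OF feasible_trace_last[OF Suc.prems]] trace_condition_last_feasible[OF Suc.prems]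
    by (simp add: funpow_Suc_right del: funpow.simps)
qed simp

end

subsection \<open>Topology on kernels\<close>

lemma continuous_on_kernel_apply:
  fixes f :: "'a::topological_space \<Rightarrow> kernel"
  assumes "continuous_on S f"
  shows "continuous_on S (\<lambda>x. f x i j)"
  using continuous_on_product_then_coordinatewise[OF
      continuous_on_product_then_coordinatewise[OF assms, of i], of j] .

lemmas continuous_on_entry = continuous_on_kernel_apply[OF continuous_on_id]

lemma continuous_on_kernelI:
  fixes f :: "'a::topological_space \<Rightarrow> kernel"
  assumes "\<And>i j. continuous_on S (\<lambda>x. f x i j)"
  shows "continuous_on S f"
  by (intro continuous_on_coordinatewise_then_product assms)

lemma continuous_on_condition_last: "continuous_on S (condition_last d w)"
  by (intro continuous_on_kernelI, unfold condition_last_def)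
     (intro continuous_on_sum continuous_on_mult continuous_on_const continuous_on_entry)

lemma continuous_on_trace_last: "continuous_on S (trace_last d)"
  by (intro continuous_on_kernelI, unfold trace_last_def)
     (intro continuous_on_sum continuous_on_entry)

lemma continuous_on_ktrace: "continuous_on S (ktrace d)"
  by (unfold ktrace_def) (intro continuous_on_sum continuous_on_entry)

lemma tendsto_continuous_image:
  assumes "(x \<longlongrightarrow> l) F" "continuous_on UNIV f"
  shows "((\<lambda>n. f (x n)) \<longlongrightarrow> f l) F"
  using continuous_on_tendsto_compose[OF assms(2,1)] by simp

text \<open>By Tychonoff, as a kernel is a point of a product of discs indexed by pairs of natural
  numbers.\<close>

lemma compact_bounded_kernels: "compact {F :: kernel. \<forall>i j. cmod (F i j) \<le> B}"
proof -
  have PiE_compact: "compact (PiE (UNIV :: nat set) (\<lambda>_. S))" if "compact S" for S :: "'b::topological_space set"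
  proof -
    have "compactin (product_topology (\<lambda>_::nat. euclidean) UNIV) (PiE UNIV (\<lambda>_. S))"
      unfolding compactin_PiE using that by simp
    then show ?thesis unfolding euclidean_product_topology by simp
  qed
  \<comment> \<open>The disc is a closed part of the continuous image of a compact square.\<close>
  have "compact ((\<lambda>(x, y). Complex x y) ` ({-B..B} \<times> {-B..B}))"
    by (intro compact_continuous_image compact_Times compact_Icc)
       (simp add: case_prod_beta Complex_eq, intro continuous_intros)
  then have "compact ((\<lambda>(x, y). Complex x y) ` ({-B..B} \<times> {-B..B}) \<inter> cball 0 B)"
    by (rule compact_Int_closed) simp
  moreover have "cball 0 B \<subseteq> (\<lambda>(x, y). Complex x y) ` ({-B..B} \<times> {-B..B})"
  proof
    fix z :: complex assume "z \<in> cball 0 B"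
    then have "\<bar>Re z\<bar> \<le> B" "\<bar>Im z\<bar> \<le> B"
      using abs_Re_le_cmod[of z] abs_Im_le_cmod[of z] by auto
    then show "z \<in> (\<lambda>(x, y). Complex x y) ` ({-B..B} \<times> {-B..B})"
      by (intro image_eqI[of _ _ "(Re z, Im z)"]) auto
  qed
  ultimately have "compact (cball (0::complex) B)" by (simp add: Int_absorb1)
  moreover have "{F :: kernel. \<forall>i j. cmod (F i j) \<le> B} = PiE UNIV (\<lambda>_. PiE UNIV (\<lambda>_. cball 0 B))"
    by (auto simp: PiE_def Pi_def)
  ultimately show ?thesis by (simp add: PiE_compact)
qed

text \<open>The map \<open>f\<close> allows for both uses: the kernel itself and its image under
  \<open>constraint\<close>.\<close>

lemma closed_psd_kernel:
  fixes f :: "kernel \<Rightarrow> kernel"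
  assumes "continuous_on UNIV f"
  shows "closed {F. psd_kernel D (f F)}"
  unfolding psd_kernel_def
  by (intro closed_Collect_conj closed_Collect_all closed_Collect_imp closed_Collect_eq
      closed_Collect_le continuous_on_const continuous_on_Re continuous_on_cnj continuous_on_sum
      continuous_on_mult continuous_on_kernel_apply[OF assms] open_Collect_const)

context sym_hierarchy
begin

lemma continuous_on_constraint: "continuous_on UNIV (constraint b)"
  by (intro continuous_on_kernelI, unfold constraint_def)
     (intro continuous_on_sum continuous_on_mult continuous_on_const continuous_on_entry)

lemma closed_feasible: "closed (feasible M)"
  unfolding feasible_def supported_def symmetric_kernel_def
  by (intro closed_Collect_conj closed_Collect_all closed_Collect_imp closed_Collect_eq
      closed_psd_kernel continuous_on_constraint continuous_on_id continuous_on_const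
      continuous_on_entry open_Collect_const)

lemma feasible_entry_bound:
  assumes "F \<in> feasible M"
  shows "cmod (F i j) \<le> 2 * Re (ktrace (d ^ Suc M) F)"
proof (cases "i < d ^ Suc M \<and> j < d ^ Suc M")
  case True
  then show ?thesis using psd_kernel_norm_le_trace[OF feasibleD(2)[OF assms]] by blast
next
  case False
  then have "F i j = 0" using feasibleD(1)[OF assms] unfolding supported_def by blast
  then show ?thesis using psd_kernel_trace(2)[OF feasibleD(2)[OF assms]] by simp
qed

subsection \<open>One-party marginals\<close>

text \<open>One-party kernels that extend to \<open>M\<close> further parties inside the
  cone.\<close>

definition marginals :: "nat \<Rightarrow> kernel set" where
  "marginals M = (trace_last d ^^ M) ` feasible M"

text \<open>The sets \<open>marginals M\<close> decrease in \<open>M\<close>. With closures taken, a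
  limit of marginals of ever larger systems belongs to the intersection.\<close>

definition limit_marginals :: "kernel set" where
  "limit_marginals = (\<Inter>M. closure (marginals M))"

definition limit_states :: "kernel set" where
  "limit_states = {\<sigma> \<in> limit_marginals. ktrace d \<sigma> = 1}"

lemma marginals_0: "marginals 0 = feasible 0"
  by (simp add: marginals_def)

lemma marginals_Suc_subset: "marginals (Suc M) \<subseteq> marginals M"
  unfolding marginals_def
  by (auto simp: funpow_Suc_right feasible_trace_last simp del: funpow.simps)

lemma marginals_antimono: "M \<le> M' \<Longrightarrow> marginals M' \<subseteq> marginals M"
  by (rule lift_Suc_antimono_le[where f = marginals]) (rule marginals_Suc_subset)

text \<open>\<open>marginals 0\<close> is the closed cone \<open>feasible 0\<close>, so limits still
  satisfy positivity and the one-party constraint exactly.\<close>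

lemma limit_marginals_feasible: "\<sigma> \<in> limit_marginals \<Longrightarrow> \<sigma> \<in> feasible 0"
  using closed_feasible[of 0] marginals_0 unfolding limit_marginals_def by fastforce

lemma limit_marginals_psd: "\<sigma> \<in> limit_marginals \<Longrightarrow> psd_kernel d \<sigma>"
  using feasibleD(2)[OF limit_marginals_feasible] by simp

lemma limit_marginals_entry_bound:
  "\<sigma> \<in> limit_marginals \<Longrightarrow> cmod (\<sigma> i j) \<le> 2 * Re (ktrace d \<sigma>)"
  using feasible_entry_bound[OF limit_marginals_feasible] by simp

lemma trace_last_funpow_scale:
  "(trace_last d ^^ M) (\<lambda>i j. c * F i j) = (\<lambda>i j. c * (trace_last d ^^ M) F i j)"
proof (induction M)
  case (Suc M)
  then show ?case by (simp add: trace_last_def sum_distrib_left)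
qed simp

lemma limit_marginals_scale:
  assumes "\<sigma> \<in> limit_marginals" "0 \<le> (c::real)"
  shows "(\<lambda>i j. of_real c * \<sigma> i j) \<in> limit_marginals"
proof -
  let ?f = "\<lambda>(F::kernel) i j. of_real c * F i j"
  have "?f \<sigma> \<in> closure (marginals M)" for M
  proof -
    have "?f ` closure (marginals M) \<subseteq> closure (marginals M)"
    proof (rule image_closure_subset)
      show "continuous_on (closure (marginals M)) ?f"
        by (intro continuous_on_kernelI continuous_on_mult continuous_on_const continuous_on_entry)
      have "?f x \<in> marginals M" if x: "x \<in> marginals M" for x
      proof -
        obtain F where F: "F \<in> feasible M" "x = (trace_last d ^^ M) F"
          using x unfolding marginals_def by blast
        have "?f x = (trace_last d ^^ M) (?f F)"
          unfolding F(2) by (rule trace_last_funpow_scale[symmetric])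
        then show ?thesis
          unfolding marginals_def using imageI[OF feasible_scale[OF F(1) assms(2)]] by (simp only:)
      qed
      then show "?f ` marginals M \<subseteq> closure (marginals M)" using closure_subset by blast
    qed simp
    then show ?thesis using assms(1) unfolding limit_marginals_def by blast
  qed
  then show ?thesis unfolding limit_marginals_def by blast
qed

text \<open>Since \<open>r n\<close> is at least \<open>n\<close> and the marginals decrease, a tail
  of the sequence lies in \<open>marginals M\<close> for each fixed \<open>M\<close>.\<close>

lemma limit_in_closure_marginals:
  assumes "strict_mono r" "(\<lambda>n. x n) \<longlonglongrightarrow> l" "\<And>n. x n \<in> marginals (r n)"
  shows "l \<in> limit_marginals"
proof -
  have "l \<in> closure (marginals M)" for M
  proof (rule Lim_in_closed_set[OF closed_closure _ _ assms(2)])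
    have "x n \<in> closure (marginals M)" if "M \<le> n" for n
      using marginals_antimono[OF order_trans[OF that seq_suble[OF assms(1)]]] assms(3) closure_subset
      by blast
    then show "\<forall>\<^sub>F n in sequentially. x n \<in> closure (marginals M)"
      unfolding eventually_sequentially by blast
  qed simp
  then show ?thesis unfolding limit_marginals_def by blast
qed

text \<open>Trace one bounds all entries, so a subsequence converges. The closed set
  \<open>Q\<close> carries a lower bound on the objective over to the limit.\<close>

lemma exists_limit_state:
  assumes "\<And>M. x M \<in> marginals M" "\<And>M. ktrace d (x M) = 1" "closed Q" "\<And>M. x M \<in> Q"
  shows "\<exists>\<sigma>. \<sigma> \<in> limit_states \<and> \<sigma> \<in> Q"
proof -
  have "cmod (x M i j) \<le> 2" for M i j
    using feasible_entry_bound[of "x M" 0 i j] assms(1)[of M] marginals_antimono[of 0 M] assms(2)[of M]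
    by (auto simp: marginals_0)
  then have "\<forall>M. x M \<in> {F. \<forall>i j. cmod (F i j) \<le> 2}" by simp
  then obtain l r where lr: "strict_mono r" "(x \<circ> r) \<longlonglongrightarrow> l"
    using compact_imp_seq_compact[OF compact_bounded_kernels] unfolding seq_compact_def by blast
  have lr2: "(\<lambda>n. x (r n)) \<longlonglongrightarrow> l" using lr(2) by (simp add: o_def)
  have "l \<in> limit_marginals"
    by (rule limit_in_closure_marginals[OF lr(1) lr2]) (rule assms(1))
  moreover have "l \<in> Q"
    by (rule Lim_in_closed_set[OF assms(3) _ _ lr2]) (auto simp: assms(4))
  moreover have "ktrace d l = 1"
  proof -
    have "(\<lambda>n. ktrace d (x (r n))) \<longlonglongrightarrow> ktrace d l"
      by (rule tendsto_continuous_image[OF lr2 continuous_on_ktrace])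
    then show ?thesis using assms(2) by (simp add: LIMSEQ_const_iff)
  qed
  ultimately show ?thesis unfolding limit_states_def by blast
qed

lemma compact_limit_states: "compact limit_states"
proof -
  have "closed limit_marginals" unfolding limit_marginals_def by (intro closed_INT) auto
  moreover have "closed {\<sigma>. ktrace d \<sigma> = 1}"
    by (intro closed_Collect_eq continuous_on_ktrace continuous_on_const)
  ultimately have "closed (limit_marginals \<inter> {\<sigma>. ktrace d \<sigma> = 1})" by (rule closed_Int)
  then have "compact ({F. \<forall>i j. cmod (F i j) \<le> 2} \<inter> (limit_marginals \<inter> {\<sigma>. ktrace d \<sigma> = 1}))"
    by (intro compact_Int_closed compact_bounded_kernels)
  moreover have "limit_states = {F. \<forall>i j. cmod (F i j) \<le> 2} \<inter> (limit_marginals \<inter> {\<sigma>. ktrace d \<sigma> = 1})"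
    unfolding limit_states_def using limit_marginals_entry_bound by fastforce
  ultimately show ?thesis by simp
qed

text \<open>\<Psi> is a limit of two-party marginals of feasible kernels whose one-party marginals
  approach \<sigma>. Conditioning commutes with tracing, so each conditioned two-party marginal is
  itself a marginal, and its limit is a limit marginal.\<close>

lemma limit_marginals_extension:
  assumes "\<sigma> \<in> limit_marginals"
  obtains \<Psi> where "\<Psi> \<in> feasible 1" "trace_last d \<Psi> = \<sigma>"
    "\<And>w. condition_last d w \<Psi> \<in> limit_marginals"
proof -
  have "\<exists>F \<in> feasible (Suc M). dist ((trace_last d ^^ Suc M) F) \<sigma> < inverse (real (Suc M))" for M
  proof -
    have "\<sigma> \<in> closure (marginals (Suc M))" using assms unfolding limit_marginals_def by blast
    then have "\<exists>y\<in>marginals (Suc M). dist y \<sigma> < inverse (real (Suc M))"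
      unfolding closure_approachable by simp
    then show ?thesis unfolding marginals_def by blast
  qed
  then obtain F where F: "\<And>M. F M \<in> feasible (Suc M)"
    "\<And>M. dist ((trace_last d ^^ Suc M) (F M)) \<sigma> < inverse (real (Suc M))" by metis
  \<comment> \<open>\<open>F M\<close> lives on \<open>M + 2\<close> parties, so tracing out
    \<open>M\<close> of them leaves two.\<close>
  define P where "P M = (trace_last d ^^ M) (F M)" for M
  have P1: "P M \<in> feasible 1" for M
    unfolding P_def using F(1)[of M] by (intro feasible_trace_last_funpow) simp
  have x: "(\<lambda>M. trace_last d (P M)) \<longlonglongrightarrow> \<sigma>"
  proof (rule metric_tendsto_imp_tendsto)
    show "(\<lambda>M. inverse (real (Suc M))) \<longlonglongrightarrow> 0" by (rule LIMSEQ_inverse_real_of_nat)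
    show "\<forall>\<^sub>F M in sequentially. dist (trace_last d (P M)) \<sigma> \<le> dist (inverse (real (Suc M))) 0"
      using F(2) unfolding P_def by (auto intro!: always_eventually less_imp_le)
  qed
  \<comment> \<open>The traces converge, hence are bounded, and the trace bounds the entries: this
    yields the compact set for the subsequence.\<close>
  have "(\<lambda>M. Re (ktrace d (trace_last d (P M)))) \<longlonglongrightarrow> Re (ktrace d \<sigma>)"
    by (intro tendsto_Re tendsto_continuous_image[OF x continuous_on_ktrace])
  then have "Bseq (\<lambda>M. Re (ktrace d (trace_last d (P M))))"
    by (intro convergent_imp_Bseq convergentI)
  then obtain B where B: "\<And>M. \<bar>Re (ktrace d (trace_last d (P M)))\<bar> \<le> B"
    unfolding Bseq_def by auto
  have "cmod (P M i j) \<le> 2 * B" for M i j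
    using feasible_entry_bound[OF P1[of M], of i j] B[of M] by (simp add: ktrace_trace_last)
  then have "\<forall>M. P M \<in> {F. \<forall>i j. cmod (F i j) \<le> 2 * B}" by simp
  then obtain \<Psi> r where lr: "strict_mono r" "(P \<circ> r) \<longlonglongrightarrow> \<Psi>"
    using compact_imp_seq_compact[OF compact_bounded_kernels] unfolding seq_compact_def by blast
  have lr2: "(\<lambda>n. P (r n)) \<longlonglongrightarrow> \<Psi>" using lr(2) by (simp add: o_def)
  show thesis
  proof
    show "\<Psi> \<in> feasible 1"
      by (rule Lim_in_closed_set[OF closed_feasible _ _ lr2]) (intro always_eventually allI P1, simp)
    have "(\<lambda>n. trace_last d (P (r n))) \<longlonglongrightarrow> trace_last d \<Psi>"
      by (rule tendsto_continuous_image[OF lr2 continuous_on_trace_last])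
    moreover have "(\<lambda>n. trace_last d (P (r n))) \<longlonglongrightarrow> \<sigma>"
      using LIMSEQ_subseq_LIMSEQ[OF x lr(1)] by (simp add: o_def)
    ultimately show "trace_last d \<Psi> = \<sigma>" by (rule LIMSEQ_unique)
    show "condition_last d w \<Psi> \<in> limit_marginals" for w
    proof (rule limit_in_closure_marginals[OF lr(1)])
      show "(\<lambda>n. condition_last d w (P (r n))) \<longlonglongrightarrow> condition_last d w \<Psi>"
        by (rule tendsto_continuous_image[OF lr2 continuous_on_condition_last])
      show "condition_last d w (P (r n)) \<in> marginals (r n)" for n
        unfolding P_def trace_condition_last_funpow[OF F(1), symmetric] marginals_def
        by (intro imageI feasible_condition_last F(1))
    qed
  qed
qed

end

subsection \<open>Pure optimal limit states\<close>

text \<open>The vectors \<open>e\<^sub>a + \<i>\<^sup>e e\<^sub>b\<close>: a tight frame whose rank-one projections also span all matrix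
  units.\<close>

definition frame_vec :: "nat \<times> nat \<times> nat \<Rightarrow> nat \<Rightarrow> complex" where
  "frame_vec = (\<lambda>(a, b, e) r. (if r = a then 1 else 0) + \<i> ^ e * (if r = b then 1 else 0))"

lemma sum_lessThan_4: "(\<Sum>e<4::nat. f e) = f 0 + f 1 + f 2 + f 3"
  by (simp add: numeral_eq_Suc)

text \<open>The cross terms carry the powers of \<i> or their conjugates, which sum to zero over
  four exponents.\<close>

lemma frame_vec_sum:
  "(\<Sum>e<4. cnj (frame_vec (a, b, e) r) * frame_vec (a, b, e) s)
     = 4 * ((if r = a \<and> s = a then 1 else 0) + (if r = b \<and> s = b then 1 else 0))"
  by (auto simp: frame_vec_def sum_lessThan_4 power3_eq_cube algebra_simps)

text \<open>The weights cancel the phase of exactly one of the four products; the other three sum to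
  zero.\<close>

lemma frame_vec_polarization:
  "(\<Sum>e<4. cnj (\<i> ^ e) * (cnj (frame_vec (a, b, e) r) * frame_vec (a, b, e) s))
     = (if r = a \<and> s = b then 4 else 0)"
  by (auto simp: frame_vec_def sum_lessThan_4 power3_eq_cube algebra_simps)

text \<open>A given index occurs \<open>d\<close> times as \<open>a\<close> and \<open>d\<close>
  times as \<open>b\<close>, each time with weight 4, whence the constant 8 d.\<close>

lemma frame_vec_tight:
  assumes "r < d" "s < d"
  shows "(\<Sum>t\<in>{..<d} \<times> {..<d} \<times> {..<4}. cnj (frame_vec t r) * frame_vec t s)
     = (if r = s then 8 * of_nat d else 0)"
proof -
  have "(\<Sum>t\<in>{..<d} \<times> {..<d} \<times> {..<4}. cnj (frame_vec t r) * frame_vec t s)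
     = (\<Sum>a<d. \<Sum>b<d. \<Sum>e<4. cnj (frame_vec (a, b, e) r) * frame_vec (a, b, e) s)"
    by (simp add: sum.cartesian_product case_prod_beta)
  also have "\<dots> = (\<Sum>a<d. \<Sum>b<d. 4 * ((if r = a \<and> s = a then 1 else 0) + (if r = b \<and> s = b then 1 else 0)))"
    by (simp only: frame_vec_sum)
  also have "\<dots> = (\<Sum>a<d. \<Sum>b<d. (if a = r then (if r = s then 4 else 0) else 0) + (if b = r then (if r = s then 4 else 0) else 0))"
    by (intro sum.cong refl) auto
  also have "\<dots> = (if r = s then 8 * of_nat d else 0)"
    using assms by (simp add: sum.distrib flip: sum_distrib_left)
  finally show ?thesis .
qed

lemma condition_last_frame_sum:
  "(\<Sum>t\<in>{..<d} \<times> {..<d} \<times> {..<4}. condition_last d (frame_vec t) F i j)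
     = 8 * of_nat d * trace_last d F i j"
proof -
  let ?T = "{..<d} \<times> {..<d} \<times> {..<4}"
  have "(\<Sum>t\<in>?T. condition_last d (frame_vec t) F i j)
     = (\<Sum>r<d. \<Sum>s<d. \<Sum>t\<in>?T. cnj (frame_vec t r) * F (i * d + r) (j * d + s) * frame_vec t s)"
    unfolding condition_last_def
    by (subst sum.swap, rule sum.cong[OF refl], rule sum.swap)
  also have "\<dots> = (\<Sum>r<d. \<Sum>s<d. F (i * d + r) (j * d + s) *
        (\<Sum>t\<in>?T. cnj (frame_vec t r) * frame_vec t s))"
    by (simp only: sum_distrib_left mult_ac)
  also have "\<dots> = (\<Sum>r<d. \<Sum>s<d. if r = s then F (i * d + r) (j * d + s) * (8 * of_nat d) else 0)"
    by (intro sum.cong refl) (simp add: frame_vec_tight)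
  also have "\<dots> = 8 * of_nat d * trace_last d F i j"
    by (simp add: trace_last_def sum_distrib_left mult_ac)
  finally show ?thesis .
qed

text \<open>The conditioned kernels over the frame determine every entry of \<open>F\<close> in the
  block of the last party.\<close>

lemma condition_last_polarization:
  assumes "a < d" "b < d"
  shows "(\<Sum>e<4. cnj (\<i> ^ e) * condition_last d (frame_vec (a, b, e)) F i j)
     = 4 * F (i * d + a) (j * d + b)"
proof -
  have "(\<Sum>e<4. cnj (\<i> ^ e) * condition_last d (frame_vec (a, b, e)) F i j)
     = (\<Sum>e<4. \<Sum>r<d. \<Sum>s<d. cnj (\<i> ^ e) *
          (cnj (frame_vec (a, b, e) r) * F (i * d + r) (j * d + s) * frame_vec (a, b, e) s))"
    unfolding condition_last_def by (simp only: sum_distrib_left)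
  also have "\<dots> = (\<Sum>r<d. \<Sum>s<d. \<Sum>e<4. cnj (\<i> ^ e) *
          (cnj (frame_vec (a, b, e) r) * F (i * d + r) (j * d + s) * frame_vec (a, b, e) s))"
    by (subst sum.swap, rule sum.cong[OF refl], rule sum.swap)
  also have "\<dots> = (\<Sum>r<d. \<Sum>s<d. F (i * d + r) (j * d + s) *
     (\<Sum>e<4. cnj (\<i> ^ e) * (cnj (frame_vec (a, b, e) r) * frame_vec (a, b, e) s)))"
    by (simp only: sum_distrib_left mult_ac)
  also have "\<dots> = (\<Sum>r<d. \<Sum>s<d. if s = b then (if r = a then 4 * F (i * d + r) (j * d + s) else 0) else 0)"
    unfolding frame_vec_polarization by (intro sum.cong refl) auto
  also have "\<dots> = 4 * F (i * d + a) (j * d + b)" using assms by simp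
  finally show ?thesis .
qed

lemma cmod_diff_scaled_sq:
  "(cmod (x - of_real p * y))\<^sup>2 = (cmod x)\<^sup>2 - 2 * p * Re (x * cnj y) + p\<^sup>2 * (cmod y)\<^sup>2"
  unfolding cmod_power2 by (simp add: power2_eq_square algebra_simps)

context sym_hierarchy
begin

text \<open>The squared Hilbert-Schmidt norm, which for Hermitian \<sigma> is the trace of its
  square.\<close>

definition purity :: "kernel \<Rightarrow> real" where
  "purity \<sigma> = (\<Sum>i<d. \<Sum>j<d. (cmod (\<sigma> i j))\<^sup>2)"

lemma purity_scale: "purity (\<lambda>i j. of_real c * \<sigma> i j) = c\<^sup>2 * purity \<sigma>"
  unfolding purity_def by (simp add: sum_distrib_left norm_mult power_mult_distrib)

lemma limit_marginals_normalize:
  assumes "\<tau> \<in> limit_marginals" "0 < Re (ktrace d \<tau>)"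
  shows "(\<lambda>i j. of_real (1 / Re (ktrace d \<tau>)) * \<tau> i j) \<in> limit_states"
proof -
  have "ktrace d (\<lambda>i j. of_real (1 / Re (ktrace d \<tau>)) * \<tau> i j) = of_real (1 / Re (ktrace d \<tau>)) * ktrace d \<tau>"
    unfolding ktrace_def by (simp only: sum_distrib_left)
  also have "\<dots> = of_real (1 / Re (ktrace d \<tau>)) * of_real (Re (ktrace d \<tau>))"
    by (subst (2) psd_kernel_trace(1)[OF limit_marginals_psd[OF assms(1)]]) (rule refl)
  also have "\<dots> = 1" using assms(2) by (simp flip: of_real_mult)
  finally show ?thesis
    unfolding limit_states_def
    using limit_marginals_scale[OF assms(1), of "1 / Re (ktrace d \<tau>)"] assms(2)
    by (intro CollectI conjI) auto
qed

text \<open>Covers the conditioned kernels of trace zero, which cannot be normalized.\<close>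

lemma limit_marginals_null:
  assumes "\<tau> \<in> limit_marginals" "Re (ktrace d \<tau>) = 0"
  shows "\<tau> i j = 0"
  using limit_marginals_entry_bound[OF assms(1), of i j] assms(2) by simp

definition kernel_value :: "kernel \<Rightarrow> kernel \<Rightarrow> real" where
  "kernel_value W \<sigma> = Re (\<Sum>r<d. \<Sum>s<d. W r s * \<sigma> s r)"

lemma continuous_on_kernel_value: "continuous_on S (kernel_value W)"
  by (unfold kernel_value_def)
     (intro continuous_on_Re continuous_on_sum continuous_on_mult continuous_on_const continuous_on_entry)

lemma continuous_on_purity: "continuous_on S purity"
  by (unfold purity_def)
     (intro continuous_on_sum continuous_on_power continuous_on_norm continuous_on_entry)

lemma kernel_value_scale: "kernel_value W (\<lambda>i j. of_real c * \<sigma> i j) = c * kernel_value W \<sigma>"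
proof -
  have "(\<Sum>r<d. \<Sum>s<d. W r s * (of_real c * \<sigma> s r)) = of_real c * (\<Sum>r<d. \<Sum>s<d. W r s * \<sigma> s r)"
    by (simp only: sum_distrib_left mult_ac)
  then show ?thesis unfolding kernel_value_def by simp
qed

lemma kernel_value_sum: "kernel_value W (\<lambda>i j. \<Sum>t\<in>T. \<tau> t i j) = (\<Sum>t\<in>T. kernel_value W (\<tau> t))"
  unfolding kernel_value_def sum_distrib_left Re_sum[symmetric]
  by (simp only: sum.swap[of _ T])

text \<open>Two nested maximizations, first of the value and then of the purity, make \<sigma> so
  extremal that its decomposition by conditioning is trivial. Hence its two-party extension is a
  product, and symmetry under a swap of row digits leaves only a rank-one kernel.\<close>

theorem pure_optimal_limit_state:
  assumes "limit_states \<noteq> {}"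
  obtains \<sigma> u v where "\<sigma> \<in> limit_states" "\<And>\<tau>. \<tau> \<in> limit_states \<Longrightarrow> kernel_value W \<tau> \<le> kernel_value W \<sigma>"
    "\<And>i j. i < d \<Longrightarrow> j < d \<Longrightarrow> \<sigma> i j = u i * v j"
proof -
  obtain \<sigma>0 where \<sigma>0: "\<sigma>0 \<in> limit_states" "\<And>\<tau>. \<tau> \<in> limit_states \<Longrightarrow> kernel_value W \<tau> \<le> kernel_value W \<sigma>0"
    using continuous_attains_sup[OF compact_limit_states assms continuous_on_kernel_value] by blast
  \<comment> \<open>The face of optimal states. It is compact, so purity attains its maximum on
    it.\<close>
  define V where "V = limit_states \<inter> {\<sigma>. kernel_value W \<sigma> = kernel_value W \<sigma>0}"
  have V: "compact V" unfolding V_def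
    by (intro compact_Int_closed compact_limit_states closed_Collect_eq continuous_on_kernel_value
        continuous_on_const)
  have "V \<noteq> {}" using \<sigma>0 unfolding V_def by blast
  then obtain \<sigma> where \<sigma>: "\<sigma> \<in> V" "\<And>\<tau>. \<tau> \<in> V \<Longrightarrow> purity \<tau> \<le> purity \<sigma>"
    using continuous_attains_sup[OF V _ continuous_on_purity] by blast
  have \<sigma>_lim: "\<sigma> \<in> limit_marginals" "ktrace d \<sigma> = 1" and \<sigma>_state: "\<sigma> \<in> limit_states"
    and \<sigma>_val: "kernel_value W \<sigma> = kernel_value W \<sigma>0"
    using \<sigma>(1) unfolding V_def limit_states_def by auto
  obtain \<Psi> where \<Psi>: "\<Psi> \<in> feasible 1" "trace_last d \<Psi> = \<sigma>"
    "\<And>w. condition_last d w \<Psi> \<in> limit_marginals"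
    using limit_marginals_extension[OF \<sigma>_lim(1)] by blast
  define T :: "(nat \<times> nat \<times> nat) set" where "T = {..<d} \<times> {..<d} \<times> {..<4}"
  have finT: "finite T" unfolding T_def by simp
  define \<tau> where "\<tau> t = condition_last d (frame_vec t) \<Psi>" for t
  define p where "p t = Re (ktrace d (\<tau> t))" for t
  have \<tau>_lim: "\<tau> t \<in> limit_marginals" for t unfolding \<tau>_def by (rule \<Psi>(3))
  have p_nonneg: "0 \<le> p t" for t
    unfolding p_def by (rule psd_kernel_trace(2)[OF limit_marginals_psd[OF \<tau>_lim]])
  have sum_\<tau>: "(\<Sum>t\<in>T. \<tau> t i j) = of_real (8 * real d) * \<sigma> i j" for i j
    unfolding \<tau>_def T_def condition_last_frame_sum \<Psi>(2) by simp
  have sum_p: "(\<Sum>t\<in>T. p t) = 8 * real d"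
  proof -
    have "(\<Sum>t\<in>T. p t) = Re (\<Sum>i<d. \<Sum>t\<in>T. \<tau> t i i)"
      unfolding p_def ktrace_def Re_sum[symmetric] by (simp only: sum.swap[of _ T])
    also have "\<dots> = Re (of_real (8 * real d) * ktrace d \<sigma>)"
      unfolding sum_\<tau> ktrace_def by (simp only: sum_distrib_left)
    finally show ?thesis using \<sigma>_lim(2) by simp
  qed
  \<comment> \<open>After normalization this is the optimality of \<sigma>; in this homogeneous form
    it includes trace zero.\<close>
  have val_le: "kernel_value W (\<tau> t) \<le> kernel_value W \<sigma> * p t" for t
  proof (cases "p t = 0")
    case True
    then have "\<tau> t = (\<lambda>i j. of_real 0 * \<tau> t i j)"
      using limit_marginals_null[OF \<tau>_lim] unfolding p_def by (intro ext) simp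
    then have "kernel_value W (\<tau> t) = 0" using kernel_value_scale[of W 0 "\<tau> t"] by simp
    then show ?thesis using True by simp
  next
    case False
    then have pos: "0 < p t" using p_nonneg[of t] by simp
    have "kernel_value W (\<lambda>i j. of_real (1 / p t) * \<tau> t i j) \<le> kernel_value W \<sigma>0"
      using \<sigma>0(2)[OF limit_marginals_normalize[OF \<tau>_lim[of t]]] pos unfolding p_def by simp
    then show ?thesis using pos unfolding kernel_value_scale \<sigma>_val by (simp add: field_simps)
  qed
  \<comment> \<open>The deficits are nonnegative and sum to zero, so each vanishes and every
    normalizable \<tau> lies in the face \<open>V\<close> after normalization.\<close>
  have val_sum: "(\<Sum>t\<in>T. kernel_value W \<sigma> * p t - kernel_value W (\<tau> t)) = 0"
  proof -
    have "(\<Sum>t\<in>T. kernel_value W (\<tau> t)) = 8 * real d * kernel_value W \<sigma>"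
      unfolding kernel_value_sum[symmetric] sum_\<tau> kernel_value_scale ..
    then show ?thesis by (simp add: sum_subtractf sum_p flip: sum_distrib_left)
  qed
  have val_eq: "kernel_value W (\<tau> t) = kernel_value W \<sigma> * p t" if "t \<in> T" for t
    using sum_nonneg_0[OF finT _ val_sum that] val_le by simp
  \<comment> \<open>\<open>H t\<close> is the Hilbert-Schmidt product of \<open>\<tau> t\<close>
    with \<sigma>, and \<open>E t\<close> is the squared distance from \<open>\<tau> t\<close> to
    \<open>p t\<close> times \<sigma>. The aim is \<open>E t = 0\<close>.\<close>
  define H where "H t = (\<Sum>i<d. \<Sum>j<d. Re (\<tau> t i j * cnj (\<sigma> i j)))" for t
  define E where "E t = (\<Sum>i<d. \<Sum>j<d. (cmod (\<tau> t i j - of_real (p t) * \<sigma> i j))\<^sup>2)" for t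
  have E_eq: "E t = purity (\<tau> t) - 2 * p t * H t + (p t)\<^sup>2 * purity \<sigma>" for t
    unfolding E_def H_def purity_def cmod_diff_scaled_sq
    by (simp only: sum.distrib sum_subtractf sum_distrib_left)
  have E_nonneg: "0 \<le> E t" for t unfolding E_def by (intro sum_nonneg) simp
  \<comment> \<open>Maximal purity of \<sigma> within \<open>V\<close> bounds the first summand in
    the expansion of \<open>E t\<close>.\<close>
  have E_le: "E t \<le> 2 * p t * (p t * purity \<sigma> - H t)" if "t \<in> T" "0 < p t" for t
  proof -
    let ?s = "\<lambda>i j. of_real (1 / p t) * \<tau> t i j"
    have "?s \<in> limit_states"
      using limit_marginals_normalize[OF \<tau>_lim[of t]] that(2) unfolding p_def by simp
    moreover have "kernel_value W ?s = kernel_value W \<sigma>0"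
      unfolding kernel_value_scale val_eq[OF that(1)] using that(2) \<sigma>_val by simp
    ultimately have "purity ?s \<le> purity \<sigma>" using \<sigma>(2) unfolding V_def by blast
    then have "purity (\<tau> t) \<le> (p t)\<^sup>2 * purity \<sigma>"
      unfolding purity_scale using that(2) by (simp add: field_simps)
    then show ?thesis unfolding E_eq by (simp add: power2_eq_square algebra_simps)
  qed
  have H_le: "0 \<le> p t * purity \<sigma> - H t" if "t \<in> T" for t
  proof (cases "p t = 0")
    case True
    then have "H t = 0" using limit_marginals_null[OF \<tau>_lim] unfolding p_def H_def by simp
    then show ?thesis using True by simp
  next
    case False
    then have pos: "0 < p t" using p_nonneg[of t] by simp
    have "0 \<le> 2 * p t * (p t * purity \<sigma> - H t)"
      using order_trans[OF E_nonneg E_le[OF that pos]] .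
    then show ?thesis using pos by (simp add: zero_le_mult_iff)
  qed
  \<comment> \<open>The \<tau> sum to a multiple of \<sigma>, so the nonnegative gaps sum to zero.
    Each gap then vanishes, and \<open>E_le\<close> forces \<open>E t\<close> to vanish as
    well.\<close>
  have H_sum: "(\<Sum>t\<in>T. p t * purity \<sigma> - H t) = 0"
  proof -
    have "(\<Sum>t\<in>T. H t) = (\<Sum>i<d. \<Sum>j<d. \<Sum>t\<in>T. Re (\<tau> t i j * cnj (\<sigma> i j)))"
      unfolding H_def by (subst sum.swap, rule sum.cong[OF refl], rule sum.swap)
    also have "\<dots> = (\<Sum>i<d. \<Sum>j<d. 8 * real d * (cmod (\<sigma> i j))\<^sup>2)"
    proof (intro sum.cong refl)
      fix i j
      have "(\<Sum>t\<in>T. Re (\<tau> t i j * cnj (\<sigma> i j))) = Re ((\<Sum>t\<in>T. \<tau> t i j) * cnj (\<sigma> i j))"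
        by (simp only: sum_distrib_right Re_sum)
      also have "\<dots> = 8 * real d * (cmod (\<sigma> i j))\<^sup>2"
        unfolding sum_\<tau> cmod_power2 by (simp add: power2_eq_square algebra_simps)
      finally show "(\<Sum>t\<in>T. Re (\<tau> t i j * cnj (\<sigma> i j))) = 8 * real d * (cmod (\<sigma> i j))\<^sup>2" .
    qed
    also have "\<dots> = 8 * real d * purity \<sigma>"
      unfolding purity_def by (simp only: sum_distrib_left)
    finally show ?thesis by (simp add: sum_subtractf sum_p flip: sum_distrib_right)
  qed
  have \<tau>_eq: "\<tau> t i j = of_real (p t) * \<sigma> i j" if "t \<in> T" "i < d" "j < d" for t i j
  proof (cases "p t = 0")
    case True
    then show ?thesis using limit_marginals_null[OF \<tau>_lim] unfolding p_def by simp
  next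
    case False
    then have pos: "0 < p t" using p_nonneg[of t] by simp
    have "p t * purity \<sigma> - H t = 0"
      using sum_nonneg_0[OF finT _ H_sum that(1)] H_le by simp
    then have "E t = 0" using E_le[OF that(1) pos] E_nonneg[of t] by simp
    then have "(\<Sum>j<d. (cmod (\<tau> t i j - of_real (p t) * \<sigma> i j))\<^sup>2) = 0"
      unfolding E_def by (rule sum_nonneg_0[rotated 2]) (use that in \<open>auto intro: sum_nonneg\<close>)
    then have "(cmod (\<tau> t i j - of_real (p t) * \<sigma> i j))\<^sup>2 = 0"
      by (rule sum_nonneg_0[rotated 2]) (use that in auto)
    then show ?thesis by simp
  qed
  \<comment> \<open>Polarizing the weights gives the other tensor factor of \<Psi>.\<close>
  define q where "q a b = (\<Sum>e<4. cnj (\<i> ^ e) * of_real (p (a, b, e))) / 4" for a b :: nat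
  have prod: "\<Psi> (i * d + a) (j * d + b) = q a b * \<sigma> i j" if "i < d" "j < d" "a < d" "b < d" for i j a b
  proof -
    have "4 * \<Psi> (i * d + a) (j * d + b) = (\<Sum>e<4. cnj (\<i> ^ e) * \<tau> (a, b, e) i j)"
      unfolding \<tau>_def by (rule condition_last_polarization[OF that(3,4), symmetric])
    also have "\<dots> = (\<Sum>e<4. cnj (\<i> ^ e) * of_real (p (a, b, e))) * \<sigma> i j"
      unfolding sum_distrib_right using that
      by (intro sum.cong refl) (simp add: \<tau>_eq T_def)
    finally show ?thesis unfolding q_def by (simp add: mult.commute)
  qed
  have swap: "q a b * \<sigma> i j = q i b * \<sigma> a j" if "i < d" "j < d" "a < d" "b < d" for i j a b
  proof -
    have lt: "x * d + y < d ^ Suc 1" if "x < d" "y < d" for x y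
      using mult_add_less_mult[OF that] by simp
    \<comment> \<open>Only the row index is swapped while the column index stays fixed, as symmetry
      under independent permutations permits.\<close>
    have "\<Psi> (i * d + a) (j * d + b) = \<Psi> (a * d + i) (j * d + b)"
    proof (rule symmetric_kernelD[OF feasibleD(3)[OF \<Psi>(1)] _ same_up_to_perm_refl])
      show "same_up_to_perm (Suc 1) d (i * d + a) (a * d + i)"
        using same_up_to_perm_swap_last[OF d_pos that(1,3), of 0 0] by simp
    qed (intro lt that)+
    then show ?thesis using that by (simp add: prod)
  qed
  \<comment> \<open>Otherwise \<Psi> would vanish on the block and \<sigma>, its partial trace,
    could not have trace one.\<close>
  have "\<exists>a<d. \<exists>b<d. q a b \<noteq> 0"
  proof (rule ccontr)
    assume *: "\<not> (\<exists>a<d. \<exists>b<d. q a b \<noteq> 0)"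
    have "\<sigma> i i = 0" if "i < d" for i
    proof -
      have "\<sigma> i i = (\<Sum>r<d. \<Psi> (i * d + r) (i * d + r))" unfolding \<Psi>(2)[symmetric] trace_last_def ..
      also have "\<dots> = 0" using * that by (intro sum.neutral) (auto simp: prod)
      finally show ?thesis .
    qed
    then show False using \<sigma>_lim(2) unfolding ktrace_def by simp
  qed
  then obtain a b where ab: "a < d" "b < d" "q a b \<noteq> 0" by blast
  show thesis
  proof
    show "\<sigma> \<in> limit_states" by (rule \<sigma>_state)
    show "kernel_value W \<tau> \<le> kernel_value W \<sigma>" if "\<tau> \<in> limit_states" for \<tau>
      unfolding \<sigma>_val using \<sigma>0(2)[OF that] .
    \<comment> \<open>With \<open>a\<close> and \<open>b\<close> fixed, the swap relation separates
      the dependence on \<open>i\<close> from that on \<open>j\<close>.\<close>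
    show "\<sigma> i j = (q i b / q a b) * \<sigma> a j" if "i < d" "j < d" for i j
      using swap[OF that ab(1,2)] ab(3) by (simp add: field_simps)
  qed
qed

end

subsection \<open>Rank factorizations\<close>

text \<open>A maximal independent set of columns has as many elements as the rank and spans all
  columns; the coefficients form the second factor.\<close>

lemma (in vec_space) rank_factorization:
  assumes A: "A \<in> carrier_mat n nc"
  obtains S :: "'a vec set" and C where "finite S" "card S = rank A"
    "\<And>i j. i < n \<Longrightarrow> j < nc \<Longrightarrow> A $$ (i, j) = (\<Sum>x\<in>S. x $ i * C x j)"
proof -
  let ?P = "\<lambda>T. T \<subseteq> set (cols A) \<and> lin_indpt T"
  obtain S where S: "finite S" "maximal S ?P"
    using maximal_exists_superset[of "set (cols A)" ?P "{}"] by (auto simp: lin_dep_def)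
  have sub: "S \<subseteq> set (cols A)" "lin_indpt S" using S(2) unfolding maximal_def by auto
  have cc: "set (cols A) \<subseteq> carrier_vec n" using cols_dim[of A] A by auto
  have car: "S \<subseteq> carrier_vec n" using sub(1) cc by blast
  have ex: "\<exists>a. col A j = lincomb a S" if j: "j < nc" for j
  proof -
    have cj: "col A j \<in> set (cols A)" using j A by (auto simp: cols_def)
    have "col A j \<in> span S"
    proof (cases "col A j \<in> S")
      case True
      then show ?thesis using in_own_span[OF car] by blast
    next
      case False
      \<comment> \<open>Maximality: adjoining another column destroys independence, so that column
        lies in the span of \<open>S\<close>.\<close>
      then have "\<not> ?P (S \<union> {col A j})" using S(2) unfolding maximal_def by blast
      then have "lin_dep (S \<union> {col A j})" using sub(1) cj by blast
      then show ?thesis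
        using lin_dep_iff_in_span[of S "col A j"] car sub(2) False cj cc by auto
    qed
    then show ?thesis unfolding finite_span[OF S(1) car] by blast
  qed
  define C where "C x j = (SOME a. col A j = lincomb a S) x" for x j
  have C: "col A j = lincomb (\<lambda>x. C x j) S" if "j < nc" for j
    using someI_ex[OF ex[OF that]] unfolding C_def by simp
  show thesis
  proof
    show "finite S" by (rule S(1))
    show "card S = rank A" using rank_card_indpt[OF A S(2)] by simp
    show "A $$ (i, j) = (\<Sum>x\<in>S. x $ i * C x j)" if "i < n" "j < nc" for i j
    proof -
      have "A $$ (i, j) = col A j $ i" using that A by simp
      also have "\<dots> = (\<Sum>x\<in>S. C x j * x $ i)"
        unfolding C[OF that(2)] by (rule lincomb_index[OF that(1) car])
      finally show ?thesis by (simp add: mult.commute)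
    qed
  qed
qed

text \<open>A sum of \<open>k\<close> products is a sum of \<open>k\<close> matrices of rank at most
  one, and rank is subadditive.\<close>

lemma crank_le_of_factorization:
  assumes "A \<in> carrier_mat n n"
    "\<And>i j. i < n \<Longrightarrow> j < n \<Longrightarrow> A $$ (i, j) = (\<Sum>l<k. B l i * C l j)"
  shows "crank A \<le> k"
proof -
  interpret vec_space "TYPE(complex)" n .
  have "rank (mat n n (\<lambda>(i, j). \<Sum>l<k. B l i * C l j)) \<le> k" for k
  proof (induction k)
    case 0
    have "mat n n (\<lambda>_. 0) = (0\<^sub>m n n :: complex mat)" by (intro eq_matI) auto
    then show ?case by (simp add: rank_0I)
  next
    case (Suc k)
    let ?M = "mat n n (\<lambda>(i, j). \<Sum>l<k. B l i * C l j)" and ?N = "mat n n (\<lambda>(i, j). B k i * C k j)"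
    have "mat n n (\<lambda>(i, j). \<Sum>l<Suc k. B l i * C l j) = ?M + ?N" by (intro eq_matI) auto
    moreover have "rank ?N \<le> 1" by (rule rank_le_1_product_entries) auto
    ultimately show ?case using rank_subadditive[of ?M n ?N] Suc by simp
  qed
  moreover have "A = mat n n (\<lambda>(i, j). \<Sum>l<k. B l i * C l j)" using assms by (intro eq_matI) auto
  ultimately show ?thesis using assms(1) unfolding crank_def by auto
qed

text \<open>Completing the square: the form of the complement at \<open>v\<close> is the form of
  \<open>R\<close> at \<open>v\<close> with its entry at \<open>p\<close> shifted suitably.\<close>

lemma psd_kernel_schur_complement:
  assumes "psd_kernel n R" "p < n" "R p p = of_real \<rho>" "0 < \<rho>"
  shows "psd_kernel n (\<lambda>i j. R i j - R i p * R p j / of_real \<rho>)"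
  unfolding psd_kernel_def
proof (intro conjI allI impI)
  fix i j assume "i < n" "j < n"
  then show "R i j - R i p * R p j / of_real \<rho> = cnj (R j i - R j p * R p i / of_real \<rho>)"
    using psd_kernel_herm[OF assms(1), of i j] psd_kernel_herm[OF assms(1), of i p]
      psd_kernel_herm[OF assms(1), of p j] assms(2) by simp
next
  fix v :: "nat \<Rightarrow> complex"
  define s where "s = (\<Sum>j<n. R p j * v j)"
  have s_cnj: "(\<Sum>i<n. cnj (v i) * R i p) = cnj s"
    unfolding s_def cnj_sum using psd_kernel_herm[OF assms(1) _ assms(2)]
    by (intro sum.cong refl) (simp add: mult.commute)
  \<comment> \<open>The shift that minimizes the form of \<open>R\<close> along the coordinate
    \<open>p\<close>.\<close>
  define t where "t = - s / of_real \<rho>"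
  let ?u = "\<lambda>i. v i + (if i = p then t else 0)"
  let ?Q = "\<Sum>i<n. \<Sum>j<n. cnj (v i) * R i j * v j"
  have inner: "(\<Sum>j<n. cnj (?u i) * R i j * ?u j) = cnj (?u i) * ((\<Sum>j<n. R i j * v j) + R i p * t)" for i
  proof -
    have "(\<Sum>j<n. cnj (?u i) * R i j * ?u j)
        = (\<Sum>j<n. cnj (?u i) * (R i j * v j) + (if j = p then cnj (?u i) * (R i j * t) else 0))"
      by (intro sum.cong refl) (simp add: distrib_left mult.assoc)
    also have "\<dots> = cnj (?u i) * (\<Sum>j<n. R i j * v j) + cnj (?u i) * (R i p * t)"
      unfolding sum.distrib using assms(2) by (simp only: sum_distrib_left) simp
    finally show ?thesis by (simp only: distrib_left)
  qed
  have "(\<Sum>i<n. \<Sum>j<n. cnj (?u i) * R i j * ?u j)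
     = (\<Sum>i<n. cnj (v i) * ((\<Sum>j<n. R i j * v j) + R i p * t)
          + (if i = p then cnj t * ((\<Sum>j<n. R i j * v j) + R i p * t) else 0))"
    unfolding inner by (intro sum.cong refl) (simp add: distrib_right)
  also have "\<dots> = (\<Sum>i<n. cnj (v i) * (\<Sum>j<n. R i j * v j)) + (\<Sum>i<n. cnj (v i) * (R i p * t))
       + cnj t * (s + R p p * t)"
    unfolding s_def using assms(2) by (simp only: sum.distrib distrib_left) simp
  also have "(\<Sum>i<n. cnj (v i) * (\<Sum>j<n. R i j * v j)) = ?Q"
    by (simp only: sum_distrib_left mult.assoc)
  also have "(\<Sum>i<n. cnj (v i) * (R i p * t)) = cnj s * t"
    unfolding s_cnj[symmetric] by (simp only: sum_distrib_right mult.assoc)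
  also have "?Q + cnj s * t + cnj t * (s + R p p * t) = ?Q - cnj s * s / of_real \<rho>"
    unfolding t_def assms(3) using assms(4) by simp
  finally have "(\<Sum>i<n. \<Sum>j<n. cnj (?u i) * R i j * ?u j) = ?Q - cnj s * s / of_real \<rho>" .
  moreover have "(\<Sum>i<n. \<Sum>j<n. cnj (v i) * (R i j - R i p * R p j / of_real \<rho>) * v j)
     = ?Q - cnj s * s / of_real \<rho>"
  proof -
    have "(\<Sum>i<n. \<Sum>j<n. cnj (v i) * (R i j - R i p * R p j / of_real \<rho>) * v j)
       = ?Q - (\<Sum>i<n. \<Sum>j<n. (cnj (v i) * R i p) * (R p j * v j)) / of_real \<rho>"
      by (simp only: right_diff_distrib left_diff_distrib sum_subtractf sum_divide_distrib) (simp add: mult_ac)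
    also have "(\<Sum>i<n. \<Sum>j<n. (cnj (v i) * R i p) * (R p j * v j)) = cnj s * s"
      by (simp only: s_cnj[symmetric] sum_product[symmetric] flip: s_def)
    finally show ?thesis .
  qed
  ultimately show "0 \<le> Re (\<Sum>i<n. \<Sum>j<n. cnj (v i) * (R i j - R i p * R p j / of_real \<rho>) * v j)"
    using psd_kernel_nonneg[OF assms(1), of ?u] by (simp only:)
qed

text \<open>Pivoting on a positive diagonal entry: the Schur complement is positive semidefinite and
  has a factorization with one summand fewer.\<close>

lemma psd_kernel_gram:
  assumes "psd_kernel n R" "finite L"
    "\<And>i j. i < n \<Longrightarrow> j < n \<Longrightarrow> R i j = (\<Sum>l\<in>L. B l i * C l j)"
  shows "\<exists>a. \<forall>i<n. \<forall>j<n. R i j = (\<Sum>l\<in>L. a l i * cnj (a l j))"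
  using assms(2,1,3)
proof (induction L arbitrary: R B C rule: finite_psubset_induct)
  case (psubset L)
  show ?case
  proof (cases "\<forall>p<n. R p p = 0")
    case True
    then have "Re (ktrace n R) = 0" by (simp add: ktrace_def)
    then have "R i j = 0" if "i < n" "j < n" for i j
      using psd_kernel_norm_le_trace[OF psubset.prems(1) that] by simp
    then show ?thesis by (intro exI[of _ "\<lambda>_ _. 0"]) simp
  next
    case False
    then obtain p where p: "p < n" "R p p \<noteq> 0" by blast
    define \<rho> where "\<rho> = Re (R p p)"
    have \<rho>: "R p p = of_real \<rho>" using psd_kernel_diag(1)[OF psubset.prems(1) p(1)] unfolding \<rho>_def .
    have \<rho>_pos: "0 < \<rho>" using psd_kernel_diag(2)[OF psubset.prems(1) p(1)] p(2) \<rho> unfolding \<rho>_def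
      by (metis of_real_0 order_less_le)
    obtain l0 where l0: "l0 \<in> L" "B l0 p \<noteq> 0"
    proof (rule ccontr)
      assume "\<not> thesis"
      then have "\<forall>l\<in>L. B l p = 0" using that by blast
      then have "R p p = 0" using psubset.prems(2)[OF p(1) p(1)] by simp
      then show False using p(2) by simp
    qed
    let ?R = "\<lambda>i j. R i j - R i p * R p j / of_real \<rho>"
    \<comment> \<open>The complement keeps the left factors \<open>B\<close>; only the right factors
      change.\<close>
    define D where "D l j = C l j - C l p * R p j / of_real \<rho>" for l j
    have R': "?R i j = (\<Sum>l\<in>L. B l i * D l j)" if "i < n" "j < n" for i j
      unfolding D_def psubset.prems(2)[OF that] psubset.prems(2)[OF that(1) p(1)]
      by (simp add: right_diff_distrib sum_subtractf sum_distrib_right sum_divide_distrib mult.assoc)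
    have split: "(\<Sum>l\<in>L. f l) = f l0 + (\<Sum>l\<in>L - {l0}. f l)" for f :: "'a \<Rightarrow> complex"
      by (rule sum.remove[OF psubset.hyps l0(1)])
    \<comment> \<open>Row \<open>p\<close> of the complement is zero. As \<open>B l0 p\<close> is
      nonzero, this relation eliminates the summand \<open>l0\<close>.\<close>
    have D0: "D l0 j = - (\<Sum>l\<in>L - {l0}. B l p * D l j) / B l0 p" if "j < n" for j
    proof -
      have "B l0 p * D l0 j + (\<Sum>l\<in>L - {l0}. B l p * D l j) = 0"
        using R'[OF p(1) that] \<rho> \<rho>_pos unfolding split by simp
      then show ?thesis using l0(2) by (simp add: field_simps add_eq_0_iff)
    qed
    have "?R i j = (\<Sum>l\<in>L - {l0}. (B l i - B l0 i * B l p / B l0 p) * D l j)" if "i < n" "j < n" for i j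
    proof -
      have "(\<Sum>l\<in>L - {l0}. (B l i - B l0 i * B l p / B l0 p) * D l j)
         = (\<Sum>l\<in>L - {l0}. B l i * D l j) - B l0 i / B l0 p * (\<Sum>l\<in>L - {l0}. B l p * D l j)"
        unfolding sum_distrib_left sum_subtractf[symmetric]
        by (intro sum.cong refl) (simp add: algebra_simps)
      then show ?thesis unfolding R'[OF that] split D0[OF that(2)] by simp
    qed
    then obtain a where a: "\<forall>i<n. \<forall>j<n. ?R i j = (\<Sum>l\<in>L - {l0}. a l i * cnj (a l j))"
      using psubset.IH[of "L - {l0}" ?R "\<lambda>l i. B l i - B l0 i * B l p / B l0 p" D] l0(1)
        psd_kernel_schur_complement[OF psubset.prems(1) p(1) \<rho> \<rho>_pos] by blast
    \<comment> \<open>The freed index \<open>l0\<close> receives the scaled pivot column, so the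
      number of vectors does not grow.\<close>
    define a' where "a' l i = (if l = l0 then R i p / of_real (sqrt \<rho>) else a l i)" for l i
    have "R i j = (\<Sum>l\<in>L. a' l i * cnj (a' l j))" if "i < n" "j < n" for i j
    proof -
      have "(\<Sum>l\<in>L. a' l i * cnj (a' l j)) = a' l0 i * cnj (a' l0 j) + (\<Sum>l\<in>L - {l0}. a l i * cnj (a l j))"
        unfolding split by (intro arg_cong2[where f = "(+)"] refl sum.cong) (auto simp: a'_def)
      also have "a' l0 i * cnj (a' l0 j) = R i p * cnj (R j p) / (of_real (sqrt \<rho>) * of_real (sqrt \<rho>))"
        unfolding a'_def by simp
      also have "\<dots> = R i p * R p j / of_real \<rho>"
        using psd_kernel_herm[OF psubset.prems(1) p(1) that(2)] \<rho>_pos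
        by (simp flip: of_real_mult)
      also have "(\<Sum>l\<in>L - {l0}. a l i * cnj (a l j)) = ?R i j" using a that by simp
      finally show ?thesis by simp
    qed
    then show ?thesis by blast
  qed
qed

text \<open>The Gram vectors are reindexed by numbers and padded with zeros up to \<open>k\<close>,
  ready to serve as components of a purification with ancilla of dimension \<open>k\<close>.\<close>

lemma psd_kernel_gram_of_crank:
  assumes "A \<in> carrier_mat n n" "psd_kernel n (\<lambda>i j. A $$ (i, j))" "crank A \<le> k"
  obtains a where "\<And>i j. i < n \<Longrightarrow> j < n \<Longrightarrow> A $$ (i, j) = (\<Sum>l<k. a l i * cnj (a l j))"
proof -
  interpret vec_space "TYPE(complex)" n .
  obtain S C where S: "finite S" "card S = rank A"
    "\<And>i j. i < n \<Longrightarrow> j < n \<Longrightarrow> A $$ (i, j) = (\<Sum>x\<in>S. x $ i * C x j)"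
    using rank_factorization[OF assms(1)] by blast
  obtain a where a: "\<forall>i<n. \<forall>j<n. A $$ (i, j) = (\<Sum>l\<in>S. a l i * cnj (a l j))"
    using psd_kernel_gram[OF assms(2) S(1), of "\<lambda>x i. x $ i" C] S(3) by blast
  have card: "card S \<le> k" using S(2) assms(1,3) unfolding crank_def by auto
  obtain h where h: "bij_betw h {..<card S} S"
    using ex_bij_betw_nat_finite[OF S(1)] by (auto simp: atLeast0LessThan)
  show thesis
  proof
    fix i j assume ij: "i < n" "j < n"
    have "A $$ (i, j) = (\<Sum>l<card S. a (h l) i * cnj (a (h l) j))"
      using a ij sum.reindex_bij_betw[OF h, of "\<lambda>l. a l i * cnj (a l j)"] by simp
    also have "\<dots> = (\<Sum>l<k. if l < card S then a (h l) i * cnj (a (h l) j) else 0)"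
      using card by (intro sum.mono_neutral_cong_left) auto
    also have "\<dots> = (\<Sum>l<k. (if l < card S then a (h l) i else 0) * cnj (if l < card S then a (h l) j else 0))"
      by (intro sum.cong refl) auto
    finally show "A $$ (i, j) = \<dots>" .
  qed
qed

subsection \<open>The symmetric projector\<close>

lemma digit_less: "0 < d \<Longrightarrow> digit N d l i < d"
  by (simp add: digit_def)

lemma ex1_index_with_digits:
  assumes "0 < d" "\<And>l. l < N \<Longrightarrow> f l < d"
  shows "\<exists>!j. j < d ^ N \<and> (\<forall>l<N. digit N d l j = f l)"
  using assms(2)
proof (induction N)
  case 0
  then show ?case by simp
next
  case (Suc N)
  have "\<exists>!j. j < d ^ N \<and> (\<forall>l<N. digit N d l j = f l)"
    using Suc.prems by (intro Suc.IH) simp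
  then obtain j where j: "j < d ^ N" "\<And>l. l < N \<Longrightarrow> digit N d l j = f l"
    and uniq: "\<And>j'. j' < d ^ N \<Longrightarrow> (\<forall>l<N. digit N d l j' = f l) \<Longrightarrow> j' = j"
    by blast
  have fN: "f N < d" using Suc.prems by simp
  show ?case
  proof (rule ex1I[of _ "j * d + f N"], intro conjI allI impI)
    show "j * d + f N < d ^ Suc N"
      using mult_add_less_mult[OF j(1) fN] by (simp add: mult.commute)
    show "digit (Suc N) d l (j * d + f N) = f l" if "l < Suc N" for l
      using that digit_Suc_last[OF assms(1) fN] j(2) by (cases "l = N") auto
    fix j' assume j': "j' < d ^ Suc N \<and> (\<forall>l<Suc N. digit (Suc N) d l j' = f l)"
    have eq: "j' = (j' div d) * d + j' mod d" by simp
    have r: "j' mod d < d" using assms(1) by simp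
    have "j' div d < d ^ N"
      using j' by (intro less_mult_imp_div_less) (simp add: mult.commute)
    moreover have "digit N d l (j' div d) = f l" if "l < N" for l
      using digit_Suc_last(1)[OF assms(1) r that, of "j' div d"] j' that eq by simp
    ultimately have "j' div d = j" using uniq by blast
    moreover have "j' mod d = f N"
      using digit_Suc_last(2)[OF assms(1) r, of N "j' div d"] j' eq by simp
    ultimately show "j' = j * d + f N" using eq by simp
  qed
qed

lemma sym_proj_entry:
  assumes "i < d ^ N" "j < d ^ N"
  shows "sym_proj N d $$ (i, j) = (\<Sum>\<sigma> | \<sigma> permutes {..<N}.
     if \<forall>l<N. digit N d l i = digit N d (\<sigma> l) j then 1 else 0) / of_nat (fact N)"
  using assms by (simp add: sym_proj_def perm_op_def)

text \<open>Composition with a fixed permutation only reorders the average over the group.\<close>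

lemma sym_proj_invariant:
  assumes "i < d ^ N" "i' < d ^ N" "j < d ^ N" "same_up_to_perm N d i i'"
  shows "sym_proj N d $$ (i, j) = sym_proj N d $$ (i', j)"
proof -
  obtain \<tau> where \<tau>: "\<tau> permutes {..<N}" "\<forall>l<N. digit N d l i = digit N d (\<tau> l) i'"
    using assms(4) unfolding same_up_to_perm_def by blast
  have inv: "Hilbert_Choice.inv \<tau> l < N" "\<tau> (Hilbert_Choice.inv \<tau> l) = l" if "l < N" for l
    using that permutes_in_image[OF permutes_inv[OF \<tau>(1)], of l] permutes_inverses(1)[OF \<tau>(1)] by auto
  have "(\<forall>l<N. digit N d l i = digit N d ((\<sigma> \<circ> \<tau>) l) j) \<longleftrightarrow>
        (\<forall>l<N. digit N d l i' = digit N d (\<sigma> l) j)" for \<sigma>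
  proof
    assume *: "\<forall>l<N. digit N d l i = digit N d ((\<sigma> \<circ> \<tau>) l) j"
    show "\<forall>l<N. digit N d l i' = digit N d (\<sigma> l) j"
      using * \<tau>(2) inv by (metis comp_apply)
  next
    assume *: "\<forall>l<N. digit N d l i' = digit N d (\<sigma> l) j"
    then show "\<forall>l<N. digit N d l i = digit N d ((\<sigma> \<circ> \<tau>) l) j"
      using \<tau> permutes_in_image[OF \<tau>(1)] by simp
  qed
  then show ?thesis
    unfolding sym_proj_entry[OF assms(1,3)] sym_proj_entry[OF assms(2,3)]
    by (subst sum_permutations_compose_right[OF \<tau>(1)]) simp
qed

lemma sym_proj_sym:
  assumes "i < d ^ N" "j < d ^ N"
  shows "sym_proj N d $$ (i, j) = sym_proj N d $$ (j, i)"
proof -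
  have "(\<forall>l<N. digit N d l i = digit N d (Hilbert_Choice.inv \<sigma> l) j) \<longleftrightarrow>
        (\<forall>l<N. digit N d l j = digit N d (\<sigma> l) i)" if "\<sigma> permutes {..<N}" for \<sigma>
  proof -
    have "\<sigma> l < N" "Hilbert_Choice.inv \<sigma> l < N" "\<sigma> (Hilbert_Choice.inv \<sigma> l) = l" "Hilbert_Choice.inv \<sigma> (\<sigma> l) = l" if "l < N" for l
      using that \<open>\<sigma> permutes {..<N}\<close> permutes_in_image[of \<sigma> "{..<N}"]
        permutes_in_image[OF permutes_inv[OF \<open>\<sigma> permutes {..<N}\<close>]] permutes_inverses by auto
    then show ?thesis by metis
  qed
  then show ?thesis
    unfolding sym_proj_entry[OF assms] sym_proj_entry[OF assms(2,1)]
    by (subst sum_permutations_inverse) simp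
qed

lemma sym_proj_nonzero:
  assumes "i < d ^ N" "j < d ^ N" "sym_proj N d $$ (i, j) \<noteq> 0"
  shows "same_up_to_perm N d i j"
proof (rule ccontr)
  assume "\<not> same_up_to_perm N d i j"
  then have "(\<Sum>\<sigma> | \<sigma> permutes {..<N}.
     if \<forall>l<N. digit N d l i = digit N d (\<sigma> l) j then 1 else (0::complex)) = 0"
    unfolding same_up_to_perm_def by (intro sum.neutral) auto
  then show False using assms(3) unfolding sym_proj_entry[OF assms(1,2)] by simp
qed

text \<open>Each permutation operator has exactly one entry 1 in every row, since a digit string
  determines its index.\<close>

lemma sym_proj_row_sum:
  assumes "0 < d" "i < d ^ N"
  shows "(\<Sum>j<d ^ N. sym_proj N d $$ (i, j)) = 1"
proof -
  have "(\<Sum>j<d ^ N. if \<forall>l<N. digit N d l i = digit N d (\<sigma> l) j then 1 else (0::complex)) = 1"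
    if \<sigma>: "\<sigma> permutes {..<N}" for \<sigma>
  proof -
    have iff: "(\<forall>l<N. digit N d l i = digit N d (\<sigma> l) j) \<longleftrightarrow>
      (\<forall>l<N. digit N d l j = digit N d (Hilbert_Choice.inv \<sigma> l) i)" for j
    proof -
      have "\<sigma> l < N" "Hilbert_Choice.inv \<sigma> l < N" "\<sigma> (Hilbert_Choice.inv \<sigma> l) = l" "Hilbert_Choice.inv \<sigma> (\<sigma> l) = l" if "l < N" for l
        using that \<sigma> permutes_in_image[OF \<sigma>] permutes_in_image[OF permutes_inv[OF \<sigma>]]
          permutes_inverses[OF \<sigma>] by auto
      then show ?thesis by metis
    qed
    obtain j0 where j0: "j0 < d ^ N" "\<forall>l<N. digit N d l j0 = digit N d (Hilbert_Choice.inv \<sigma> l) i"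
      "\<And>j. j < d ^ N \<Longrightarrow> (\<forall>l<N. digit N d l j = digit N d (Hilbert_Choice.inv \<sigma> l) i) \<Longrightarrow> j = j0"
      using ex1_index_with_digits[OF assms(1), of N "\<lambda>l. digit N d (Hilbert_Choice.inv \<sigma> l) i",
          OF digit_less[OF assms(1)]] by blast
    have "(\<Sum>j<d ^ N. if \<forall>l<N. digit N d l i = digit N d (\<sigma> l) j then 1 else (0::complex))
       = (\<Sum>j<d ^ N. if j = j0 then 1 else 0)"
    proof (intro sum.cong refl)
      fix j assume "j \<in> {..<d ^ N}"
      then have j: "j < d ^ N" by simp
      have "(\<forall>l<N. digit N d l i = digit N d (\<sigma> l) j) \<longleftrightarrow> j = j0"
        unfolding iff
      proof
        show "j = j0" if "\<forall>l<N. digit N d l j = digit N d (Hilbert_Choice.inv \<sigma> l) i"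
          by (rule j0(3)[OF j that])
        show "\<forall>l<N. digit N d l j = digit N d (Hilbert_Choice.inv \<sigma> l) i" if "j = j0"
          unfolding that by (rule j0(2))
      qed
      then show "(if \<forall>l<N. digit N d l i = digit N d (\<sigma> l) j then 1 else (0::complex)) = (if j = j0 then 1 else 0)"
        by (simp only:)
    qed
    then show ?thesis using j0(1) by simp
  qed
  then have "(\<Sum>\<sigma> | \<sigma> permutes {..<N}. \<Sum>j<d ^ N.
      if \<forall>l<N. digit N d l i = digit N d (\<sigma> l) j then 1 else (0::complex)) = of_nat (fact N)"
    using card_permutations[of "{..<N}" N] by simp
  moreover have "(\<Sum>j<d ^ N. sym_proj N d $$ (i, j)) = (\<Sum>j<d ^ N. \<Sum>\<sigma> | \<sigma> permutes {..<N}.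
      if \<forall>l<N. digit N d l i = digit N d (\<sigma> l) j then 1 else (0::complex)) / of_nat (fact N)"
    unfolding sum_divide_distrib
    by (intro sum.cong refl) (simp add: sym_proj_entry[OF assms(2)] sum_divide_distrib)
  ultimately show ?thesis by (subst (asm) sum.swap) simp
qed

lemma mult_mat_entry:
  assumes "A \<in> carrier_mat a b" "B \<in> carrier_mat b c" "i < a" "j < c"
  shows "(A * B) $$ (i, j) = (\<Sum>l<b. A $$ (i, l) * B $$ (l, j))"
  using assms by (simp add: scalar_prod_def atLeast0LessThan)

text \<open>The projector averages over orbits: its entries are constant on them, vanish between
  different orbits, and sum to one along rows. So the sandwich is always invariant, and it fixes
  whatever is invariant.\<close>

lemma sym_proj_sandwich_iff:
  assumes "0 < d" and \<Phi>: "\<Phi> \<in> carrier_mat (d ^ N) (d ^ N)"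
  shows "sym_proj N d * \<Phi> * sym_proj N d = \<Phi> \<longleftrightarrow> symmetric_kernel N d (\<lambda>i j. \<Phi> $$ (i, j))"
proof -
  let ?P = "sym_proj N d" and ?D = "d ^ N"
  have P: "?P \<in> carrier_mat ?D ?D" by (simp add: sym_proj_def)
  have entry: "(?P * \<Phi> * ?P) $$ (i, j)
      = (\<Sum>j'<?D. (\<Sum>i'<?D. ?P $$ (i, i') * \<Phi> $$ (i', j')) * ?P $$ (j', j))" if "i < ?D" "j < ?D" for i j
    unfolding mult_mat_entry[OF mult_carrier_mat[OF P \<Phi>] P that]
    by (intro sum.cong refl) (use that in \<open>simp add: mult_mat_entry[OF P \<Phi>]\<close>)
  show ?thesis
  proof
    assume eq: "?P * \<Phi> * ?P = \<Phi>"
    show "symmetric_kernel N d (\<lambda>i j. \<Phi> $$ (i, j))"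
      unfolding symmetric_kernel_def
    proof (intro allI impI)
      fix i i' j j'
      assume *: "i < ?D" "i' < ?D" "j < ?D" "j' < ?D" "same_up_to_perm N d i i'" "same_up_to_perm N d j j'"
      have col: "?P $$ (l, j) = ?P $$ (l, j')" if "l < ?D" for l
        using sym_proj_invariant[OF *(3,4) that *(6)] sym_proj_sym[OF that] * by simp
      have row: "?P $$ (i, l) = ?P $$ (i', l)" if "l < ?D" for l
        using sym_proj_invariant[OF *(1,2) that *(5)] .
      have "(?P * \<Phi> * ?P) $$ (i, j) = (?P * \<Phi> * ?P) $$ (i', j')"
        unfolding entry[OF *(1,3)] entry[OF *(2,4)]
        by (intro sum.cong refl) (simp add: col row)
      then show "\<Phi> $$ (i, j) = \<Phi> $$ (i', j')" unfolding eq .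
    qed
  next
    assume sym: "symmetric_kernel N d (\<lambda>i j. \<Phi> $$ (i, j))"
    show "?P * \<Phi> * ?P = \<Phi>"
    proof (rule eq_matI)
      fix i j assume "i < dim_row \<Phi>" "j < dim_col \<Phi>"
      then have ij: "i < ?D" "j < ?D" using \<Phi> by auto
      have "?P $$ (i, i') * \<Phi> $$ (i', j') * ?P $$ (j', j) = ?P $$ (i, i') * \<Phi> $$ (i, j) * ?P $$ (j, j')"
        if "i' < ?D" "j' < ?D" for i' j'
      proof (cases "?P $$ (i, i') = 0 \<or> ?P $$ (j, j') = 0")
        case True
        then show ?thesis using sym_proj_sym[OF that(2) ij(2)] by auto
      next
        case False
        then have "same_up_to_perm N d i i'" "same_up_to_perm N d j j'"
          using sym_proj_nonzero ij that by blast+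
        then show ?thesis
          using symmetric_kernelD[OF sym _ _ ij(1) that(1) ij(2) that(2)] sym_proj_sym[OF that(2) ij(2)] by simp
      qed
      then have "(?P * \<Phi> * ?P) $$ (i, j)
          = (\<Sum>j'<?D. \<Sum>i'<?D. ?P $$ (i, i') * \<Phi> $$ (i, j) * ?P $$ (j, j'))"
        unfolding entry[OF ij] sum_distrib_right by (intro sum.cong refl) simp
      also have "\<dots> = (\<Sum>i'<?D. ?P $$ (i, i')) * \<Phi> $$ (i, j) * (\<Sum>j'<?D. ?P $$ (j, j'))"
        by (simp only: sum_distrib_right sum_distrib_left)
      finally show "(?P * \<Phi> * ?P) $$ (i, j) = \<Phi> $$ (i, j)"
        using sym_proj_row_sum[OF assms(1)] ij by simp
    qed (use P \<Phi> in auto)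
  qed
qed

subsection \<open>Tensor powers of a vector\<close>

text \<open>The base case vanishes at positive indices, so for positive \<open>d\<close> the power
  vanishes from \<open>d ^ N\<close> on, as \<open>supported\<close> demands.\<close>

primrec tensor_power :: "nat \<Rightarrow> (nat \<Rightarrow> complex) \<Rightarrow> nat \<Rightarrow> nat \<Rightarrow> complex" where
  "tensor_power d \<phi> 0 i = (if i = 0 then 1 else 0)"
| "tensor_power d \<phi> (Suc N) i = tensor_power d \<phi> N (i div d) * \<phi> (i mod d)"

lemma tensor_power_eq_0:
  assumes "0 < d"
  shows "d ^ N \<le> i \<Longrightarrow> tensor_power d \<phi> N i = 0"
proof (induction N arbitrary: i)
  case (Suc N)
  then have "d ^ N \<le> i div d" using assms by (simp add: less_eq_div_iff_mult_less_eq mult.commute)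
  then show ?case using Suc.IH by simp
qed simp

lemma tensor_power_eq_prod:
  assumes "0 < d"
  shows "i < d ^ N \<Longrightarrow> tensor_power d \<phi> N i = (\<Prod>l<N. \<phi> (digit N d l i))"
proof (induction N arbitrary: i)
  case (Suc N)
  have "i div d < d ^ N"
    using Suc.prems by (intro less_mult_imp_div_less) (simp add: mult.commute)
  moreover have "digit (Suc N) d N i = i mod d" by (simp add: digit_def)
  moreover have "digit (Suc N) d l i = digit N d l (i div d)" if "l < N" for l
    using digit_Suc_last(1)[OF assms mod_less_divisor[OF assms] that, of "i div d" i] by simp
  ultimately show ?case using Suc.IH by simp
qed simp

lemma tensor_power_perm:
  assumes "0 < d" "i < d ^ N" "i' < d ^ N" "same_up_to_perm N d i i'"
  shows "tensor_power d \<phi> N i = tensor_power d \<phi> N i'"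
proof -
  obtain \<tau> where \<tau>: "\<tau> permutes {..<N}" "\<forall>l<N. digit N d l i = digit N d (\<tau> l) i'"
    using assms(4) unfolding same_up_to_perm_def by blast
  have "(\<Prod>l<N. \<phi> (digit N d l i)) = (\<Prod>l<N. ((\<lambda>l. \<phi> (digit N d l i')) \<circ> \<tau>) l)"
    using \<tau>(2) by (intro prod.cong) auto
  also have "\<dots> = (\<Prod>l<N. \<phi> (digit N d l i'))"
    by (simp only: prod.permute[OF \<tau>(1), symmetric])
  finally show ?thesis using assms by (simp add: tensor_power_eq_prod)
qed

text \<open>The recursion peels off the last party, whereas the constraint acts on the
  first.\<close>

lemma tensor_power_first:
  assumes "r < d"
  shows "i < d ^ M \<Longrightarrow> tensor_power d \<phi> (Suc M) (r * d ^ M + i) = \<phi> r * tensor_power d \<phi> M i"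
proof (induction M arbitrary: i)
  case 0
  then show ?case using assms by simp
next
  case (Suc M)
  have d: "0 < d" using assms by simp
  have "i div d < d ^ M"
    using Suc.prems by (intro less_mult_imp_div_less) (simp add: mult.commute)
  moreover have "(r * d ^ Suc M + i) div d = r * d ^ M + i div d" "(r * d ^ Suc M + i) mod d = i mod d"
    using d by (simp_all add: mult.left_commute[of r d])
  ultimately show ?case
    using Suc.IH[of "i div d"] by (subst tensor_power.simps(2)) (simp del: power_Suc)
qed

text \<open>Contracting the test vector with \<psi> in the second factor reduces the form to that of
  \<open>H\<close>.\<close>

lemma psd_kernel_tensor_rank_one:
  assumes "psd_kernel m H"
  shows "psd_kernel (m * b) (\<lambda>I J. H (I div b) (J div b) * (\<psi> (I mod b) * cnj (\<psi> (J mod b))))"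
  unfolding psd_kernel_def
proof (intro conjI allI impI)
  fix I J assume IJ: "I < m * b" "J < m * b"
  then have "I div b < m" "J div b < m" by (auto intro: less_mult_imp_div_less)
  then show "H (I div b) (J div b) * (\<psi> (I mod b) * cnj (\<psi> (J mod b)))
     = cnj (H (J div b) (I div b) * (\<psi> (J mod b) * cnj (\<psi> (I mod b))))"
    using psd_kernel_herm[OF assms, of "I div b" "J div b"] by simp
next
  fix v :: "nat \<Rightarrow> complex"
  define u where "u c = (\<Sum>j<b. cnj (\<psi> j) * v (c * b + j))" for c
  have "(\<Sum>I<m * b. \<Sum>J<m * b. cnj (v I) *
           (H (I div b) (J div b) * (\<psi> (I mod b) * cnj (\<psi> (J mod b)))) * v J)
     = (\<Sum>a<m. \<Sum>i<b. \<Sum>c<m. \<Sum>j<b. cnj (v (a * b + i)) *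
           (H a c * (\<psi> i * cnj (\<psi> j))) * v (c * b + j))"
    unfolding sum_lessThan_mult by (intro sum.cong refl) simp
  also have "\<dots> = (\<Sum>a<m. \<Sum>c<m. \<Sum>i<b. \<Sum>j<b. cnj (v (a * b + i)) *
           (H a c * (\<psi> i * cnj (\<psi> j))) * v (c * b + j))"
    by (rule sum.cong[OF refl], rule sum.swap)
  also have "\<dots> = (\<Sum>a<m. \<Sum>c<m. cnj (u a) * H a c * u c)"
  proof (intro sum.cong refl)
    fix a c
    have "cnj (u a) * H a c * u c
        = H a c * ((\<Sum>i<b. \<psi> i * cnj (v (a * b + i))) * (\<Sum>j<b. cnj (\<psi> j) * v (c * b + j)))"
      unfolding u_def by (simp add: mult_ac)
    also have "\<dots> = (\<Sum>i<b. \<Sum>j<b. cnj (v (a * b + i)) * (H a c * (\<psi> i * cnj (\<psi> j))) * v (c * b + j))"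
      by (simp only: sum_product, simp only: sum_distrib_left, intro sum.cong refl, simp add: mult_ac)
    finally show "(\<Sum>i<b. \<Sum>j<b. cnj (v (a * b + i)) * (H a c * (\<psi> i * cnj (\<psi> j))) * v (c * b + j))
        = cnj (u a) * H a c * u c" by simp
  qed
  finally show "0 \<le> Re (\<Sum>I<m * b. \<Sum>J<m * b. cnj (v I) *
           (H (I div b) (J div b) * (\<psi> (I mod b) * cnj (\<psi> (J mod b)))) * v J)"
    using psd_kernel_nonneg[OF assms, of u] by (simp only:)
qed

lemma psd_kernel_rank_one: "psd_kernel D (\<lambda>i j. \<psi> i * cnj (\<psi> j))"
proof -
  have "psd_kernel 1 (\<lambda>_ _. 1)"
    by (simp add: psd_kernel_def complex_mult_cnj power2_eq_square)
  from psd_kernel_tensor_rank_one[OF this, of D \<psi>] show ?thesis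
    by (subst psd_kernel_cong[where G = "\<lambda>I J. 1 * (\<psi> (I mod D) * cnj (\<psi> (J mod D)))"]) auto
qed

context sym_hierarchy
begin

definition pure_kernel :: "nat \<Rightarrow> (nat \<Rightarrow> complex) \<Rightarrow> kernel" where
  "pure_kernel M \<phi> = (\<lambda>i j. tensor_power d \<phi> (Suc M) i * cnj (tensor_power d \<phi> (Suc M) j))"

lemma pure_kernel_0: "i < d \<Longrightarrow> j < d \<Longrightarrow> pure_kernel 0 \<phi> i j = \<phi> i * cnj (\<phi> j)"
  by (simp add: pure_kernel_def)

lemma trace_last_pure_kernel:
  assumes "(\<Sum>r<d. \<phi> r * cnj (\<phi> r)) = 1"
  shows "trace_last d (pure_kernel (Suc M) \<phi>) = pure_kernel M \<phi>"
proof (intro ext)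
  fix i j
  have "trace_last d (pure_kernel (Suc M) \<phi>) i j
     = (\<Sum>r<d. pure_kernel M \<phi> i j * (\<phi> r * cnj (\<phi> r)))"
    unfolding trace_last_def pure_kernel_def
    by (intro sum.cong refl) (simp add: mult_ac del: tensor_power.simps add: tensor_power.simps(2)[of d \<phi> "Suc M"])
  then show "trace_last d (pure_kernel (Suc M) \<phi>) i j = pure_kernel M \<phi> i j"
    using assms by (simp flip: sum_distrib_left)
qed

text \<open>The limit of the tracing is written \<open>pure_kernel 0 \<phi>\<close> because this
  kernel vanishes outside the block, where products of values of \<phi> need not.\<close>

lemma trace_last_funpow_pure_kernel:
  assumes "(\<Sum>r<d. \<phi> r * cnj (\<phi> r)) = 1"
  shows "(trace_last d ^^ M) (pure_kernel M \<phi>) = pure_kernel 0 \<phi>"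
  by (induction M) (simp_all add: funpow_Suc_right trace_last_pure_kernel[OF assms] del: funpow.simps(2))

text \<open>For a product state the constraint factors into the one-party constraint and the
  rank-one kernel of the other \<open>M\<close> parties.\<close>

lemma pure_kernel_feasible:
  assumes "psd_kernel m (constraint 1 (\<lambda>r s. \<phi> r * cnj (\<phi> s)))"
  shows "pure_kernel M \<phi> \<in> feasible M"
proof (rule feasibleI)
  show "supported (d ^ Suc M) (pure_kernel M \<phi>)"
    unfolding supported_def pure_kernel_def
    using tensor_power_eq_0[OF d_pos, of "Suc M"] by (auto simp: not_less simp del: tensor_power.simps power_Suc)
  show "psd_kernel (d ^ Suc M) (pure_kernel M \<phi>)"
    unfolding pure_kernel_def by (rule psd_kernel_rank_one)
  show "symmetric_kernel (Suc M) d (pure_kernel M \<phi>)"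
    unfolding symmetric_kernel_def pure_kernel_def
    by (intro allI impI arg_cong2[where f = "(*)"] arg_cong[where f = cnj] tensor_power_perm[OF d_pos])
  have *: "constraint (d ^ M) (pure_kernel M \<phi>) I J
     = constraint 1 (\<lambda>r s. \<phi> r * cnj (\<phi> s)) (I div d ^ M) (J div d ^ M)
       * (tensor_power d \<phi> M (I mod d ^ M) * cnj (tensor_power d \<phi> M (J mod d ^ M)))" for I J
  proof -
    have lt: "I mod d ^ M < d ^ M" for I using d_pos by simp
    show ?thesis
      unfolding constraint_def pure_kernel_def sum_distrib_right
      by (intro sum.cong refl) (simp add: tensor_power_first[OF _ lt] mult_ac del: tensor_power.simps)
  qed
  show "psd_kernel (m * d ^ M) (constraint (d ^ M) (pure_kernel M \<phi>))"
    unfolding psd_kernel_cong[OF *] by (rule psd_kernel_tensor_rank_one[OF assms])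
qed

end

subsection \<open>Matrices as kernels\<close>

text \<open>Entries beyond the dimensions of a matrix are unspecified, hence the explicit
  zeros.\<close>

definition kernel_of_mat :: "complex mat \<Rightarrow> kernel" where
  "kernel_of_mat A = (\<lambda>i j. if i < dim_row A \<and> j < dim_col A then A $$ (i, j) else 0)"

lemma psd_iff_psd_kernel:
  assumes "A \<in> carrier_mat D D"
  shows "psd A \<longleftrightarrow> psd_kernel D (\<lambda>i j. A $$ (i, j))"
proof -
  have dim: "dim_row A = D" "dim_col A = D" using assms by auto
  have "(\<forall>v\<in>carrier_vec D. 0 \<le> Re (\<Sum>i<D. \<Sum>j<D. cnj (v $ i) * A $$ (i, j) * v $ j))
     \<longleftrightarrow> (\<forall>v. 0 \<le> Re (\<Sum>i<D. \<Sum>j<D. cnj (v i) * A $$ (i, j) * v j))"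
    (is "?L \<longleftrightarrow> ?R")
  proof
    assume L: ?L
    show ?R
    proof
      fix v :: "nat \<Rightarrow> complex"
      have "(\<Sum>i<D. \<Sum>j<D. cnj (vec D v $ i) * A $$ (i, j) * vec D v $ j)
         = (\<Sum>i<D. \<Sum>j<D. cnj (v i) * A $$ (i, j) * v j)"
        by (intro sum.cong refl) simp
      then show "0 \<le> Re (\<Sum>i<D. \<Sum>j<D. cnj (v i) * A $$ (i, j) * v j)"
        using bspec[OF L vec_carrier[of D v]] by (simp only:)
    qed
  qed blast
  then show ?thesis unfolding psd_def herm_def psd_kernel_def dim by blast
qed

lemma psd_kernel_of_mat:
  assumes "A \<in> carrier_mat D D"
  shows "psd A \<longleftrightarrow> psd_kernel D (kernel_of_mat A)"
  unfolding psd_iff_psd_kernel[OF assms] kernel_of_mat_def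
  using assms by (intro psd_kernel_cong) auto

lemma mtrace_eq_ktrace:
  assumes "A \<in> carrier_mat D D"
  shows "mtrace A = ktrace D (kernel_of_mat A)"
  unfolding mtrace_def ktrace_def kernel_of_mat_def using assms by (intro sum.cong) auto

lemma kernel_of_mat_mat:
  assumes "supported D F"
  shows "kernel_of_mat (mat D D (\<lambda>(i, j). F i j)) = F"
  using assms unfolding kernel_of_mat_def supported_def by (intro ext) auto

lemma mtrace_mult:
  assumes "A \<in> carrier_mat D D" "B \<in> carrier_mat D D"
  shows "mtrace (A * B) = (\<Sum>i<D. \<Sum>j<D. A $$ (i, j) * B $$ (j, i))"
  unfolding mtrace_def using assms by (intro sum.cong) (auto simp: mult_mat_entry simp del: index_mult_mat(1))

lemma kron_carrier:
  assumes "A \<in> carrier_mat a b" "B \<in> carrier_mat c e"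
  shows "kron A B \<in> carrier_mat (a * c) (b * e)"
  using assms by (auto simp: kron_def)

text \<open>The duality between tensoring with the identity and the partial trace. It serves both
  for the ancilla of dimension \<open>k\<close> and for the parties after the first.\<close>

lemma kron_one_sum:
  assumes "A \<in> carrier_mat a a" "0 < b"
  shows "(\<Sum>I<a * b. \<Sum>J<a * b. kron A (1\<^sub>m b) $$ (I, J) * F J I)
     = (\<Sum>r<a. \<Sum>s<a. A $$ (r, s) * (\<Sum>i<b. F (s * b + i) (r * b + i)))"
proof -
  have kron: "kron A (1\<^sub>m b) $$ (r * b + i, s * b + j) = (if j = i then A $$ (r, s) else 0)"
    if "r < a" "s < a" "i < b" "j < b" for r s i j
    using that assms mult_add_less_mult[of r a i b] mult_add_less_mult[of s a j b]
    by (auto simp: kron_def)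
  have "(\<Sum>I<a * b. \<Sum>J<a * b. kron A (1\<^sub>m b) $$ (I, J) * F J I)
     = (\<Sum>r<a. \<Sum>i<b. \<Sum>s<a. \<Sum>j<b. if j = i then A $$ (r, s) * F (s * b + j) (r * b + i) else 0)"
    unfolding sum_lessThan_mult by (intro sum.cong refl) (auto simp: kron)
  also have "\<dots> = (\<Sum>r<a. \<Sum>s<a. \<Sum>i<b. A $$ (r, s) * F (s * b + i) (r * b + i))"
    by (rule sum.cong[OF refl]) (subst sum.swap, simp)
  finally show ?thesis by (simp only: sum_distrib_left)
qed

lemma trace_last_funpow:
  "(trace_last d ^^ M) F i j = (\<Sum>l<d ^ M. F (i * d ^ M + l) (j * d ^ M + l))"
proof (induction M arbitrary: F)
  case (Suc M)
  have "(trace_last d ^^ Suc M) F i j = (\<Sum>l<d ^ M. \<Sum>r<d. F ((i * d ^ M + l) * d + r) ((j * d ^ M + l) * d + r))"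
    by (simp add: funpow_Suc_right Suc.IH trace_last_def del: funpow.simps)
  also have "\<dots> = (\<Sum>l<d ^ M * d. F (i * d ^ Suc M + l) (j * d ^ Suc M + l))"
    unfolding sum_lessThan_mult by (intro sum.cong refl) (simp add: algebra_simps)
  finally show ?case by (simp add: mult.commute)
qed simp

lemma ktrace_trace_last_funpow: "ktrace d ((trace_last d ^^ M) F) = ktrace (d ^ Suc M) F"
  by (simp add: ktrace_def trace_last_funpow sum_lessThan_mult)

section \<open>Linear maps in coordinates\<close>

definition unit_mat :: "nat \<Rightarrow> nat \<times> nat \<Rightarrow> complex mat" where
  "unit_mat n x = mat n n (\<lambda>y. if y = x then 1 else 0)"

text \<open>Additivity is applied one entry at a time, by induction on the set of positions that are
  kept.\<close>

lemma linear_map_expansion: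
  assumes \<Lambda>: "herm_preserving_linear n m \<Lambda>" and A: "A \<in> carrier_mat n n" and ac: "a < m" "c < m"
  shows "\<Lambda> A $$ (a, c) = (\<Sum>p<n. \<Sum>q<n. \<Lambda> (unit_mat n (p, q)) $$ (a, c) * A $$ (p, q))"
proof -
  have car: "\<Lambda> B \<in> carrier_mat m m" if "B \<in> carrier_mat n n" for B
    using \<Lambda> that unfolding herm_preserving_linear_def by blast
  have add: "\<Lambda> (B + C) = \<Lambda> B + \<Lambda> C" if "B \<in> carrier_mat n n" "C \<in> carrier_mat n n" for B C
    using \<Lambda> that unfolding herm_preserving_linear_def by blast
  have smult: "\<Lambda> (z \<cdot>\<^sub>m B) = z \<cdot>\<^sub>m \<Lambda> B" if "B \<in> carrier_mat n n" for B z
    using \<Lambda> that unfolding herm_preserving_linear_def by blast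
  have u: "unit_mat n x \<in> carrier_mat n n" for x by (simp add: unit_mat_def)
  have "\<Lambda> (mat n n (\<lambda>y. if y \<in> S then A $$ y else 0)) $$ (a, c)
      = (\<Sum>x\<in>S. \<Lambda> (unit_mat n x) $$ (a, c) * A $$ x)" if "finite S" for S
    using that
  proof (induction S rule: finite_induct)
    case empty
    \<comment> \<open>Homogeneity with scalar 0 gives the value at the zero matrix.\<close>
    have "mat n n (\<lambda>y. 0) = 0 \<cdot>\<^sub>m unit_mat n (0, 0)" by (intro eq_matI) (auto simp: unit_mat_def)
    then have "\<Lambda> (mat n n (\<lambda>y. 0)) $$ (a, c) = 0"
      using smult[OF u, of 0 "(0, 0)"] car[OF u, of "(0, 0)"] ac by simp
    then show ?case by simp
  next
    case (insert x S)
    let ?B = "mat n n (\<lambda>y. if y \<in> S then A $$ y else 0)"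
    have B: "?B \<in> carrier_mat n n" by simp
    have "mat n n (\<lambda>y. if y \<in> insert x S then A $$ y else 0) = ?B + A $$ x \<cdot>\<^sub>m unit_mat n x"
      using insert.hyps(2) by (intro eq_matI) (auto simp: unit_mat_def)
    then have "\<Lambda> (mat n n (\<lambda>y. if y \<in> insert x S then A $$ y else 0)) $$ (a, c)
        = \<Lambda> ?B $$ (a, c) + A $$ x * \<Lambda> (unit_mat n x) $$ (a, c)"
      using add[OF B smult_carrier_mat[OF u]] smult[OF u] car[OF B] car[OF u, of x] ac by simp
    then show ?case using insert by (simp add: mult.commute)
  qed
  from this[of "{..<n} \<times> {..<n}"]
  have "\<Lambda> (mat n n (\<lambda>y. if y \<in> {..<n} \<times> {..<n} then A $$ y else 0)) $$ (a, c)
      = (\<Sum>p<n. \<Sum>q<n. \<Lambda> (unit_mat n (p, q)) $$ (a, c) * A $$ (p, q))"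
    by (simp add: sum.cartesian_product case_prod_beta)
  moreover have "mat n n (\<lambda>y. if y \<in> {..<n} \<times> {..<n} then A $$ y else 0) = A"
    using A by (intro eq_matI) auto
  ultimately show ?thesis by simp
qed

text \<open>\<open>r div k\<close> and \<open>r mod k\<close> are the components of \<open>r\<close>
  in the system and in the ancilla; comparing remainders implements the partial trace over the
  ancilla.\<close>

definition constraint_coeff ::
  "nat \<Rightarrow> nat \<Rightarrow> (complex mat \<Rightarrow> complex mat) \<Rightarrow> complex mat \<Rightarrow> nat \<Rightarrow> nat \<Rightarrow> nat \<Rightarrow> nat \<Rightarrow> complex" where
  "constraint_coeff n k \<Lambda> Y a c r s = (if s = r then Y $$ (a, c) else 0)
     - (if s mod k = r mod k then \<Lambda> (unit_mat n (r div k, s div k)) $$ (a, c) else 0)"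

lemma constraint_coeff_sum:
  assumes \<Lambda>: "herm_preserving_linear n m \<Lambda>" and ac: "a < m" "c < m" and k: "0 < k"
  shows "(\<Sum>r<n * k. \<Sum>s<n * k. constraint_coeff n k \<Lambda> Y a c r s * F r s)
     = Y $$ (a, c) * (\<Sum>r<n * k. F r r)
       - \<Lambda> (mat n n (\<lambda>(p, q). trace_last k F p q)) $$ (a, c)"
proof -
  let ?l = "\<lambda>p q. \<Lambda> (unit_mat n (p, q)) $$ (a, c)"
  have "(\<Sum>r<n * k. \<Sum>s<n * k. constraint_coeff n k \<Lambda> Y a c r s * F r s)
     = (\<Sum>r<n * k. \<Sum>s<n * k. if s = r then Y $$ (a, c) * F r s else 0)
       - (\<Sum>r<n * k. \<Sum>s<n * k. if s mod k = r mod k then ?l (r div k) (s div k) * F r s else 0)"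
    unfolding sum_subtractf[symmetric]
    by (intro sum.cong refl) (simp add: constraint_coeff_def left_diff_distrib)
  also have "(\<Sum>r<n * k. \<Sum>s<n * k. if s = r then Y $$ (a, c) * F r s else 0) = Y $$ (a, c) * (\<Sum>r<n * k. F r r)"
    by (simp add: sum_distrib_left)
  also have "(\<Sum>r<n * k. \<Sum>s<n * k. if s mod k = r mod k then ?l (r div k) (s div k) * F r s else 0)
     = (\<Sum>p<n. \<Sum>u<k. \<Sum>q<n. \<Sum>u'<k. if u' = u then ?l p q * F (p * k + u) (q * k + u') else 0)"
    unfolding sum_lessThan_mult by (intro sum.cong refl) auto
  also have "\<dots> = (\<Sum>p<n. \<Sum>q<n. \<Sum>u<k. ?l p q * F (p * k + u) (q * k + u))"
    by (rule sum.cong[OF refl]) (subst sum.swap, simp)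
  also have "\<dots> = (\<Sum>p<n. \<Sum>q<n. ?l p q * trace_last k F p q)"
    by (simp only: trace_last_def sum_distrib_left)
  also have "\<dots> = \<Lambda> (mat n n (\<lambda>(p, q). trace_last k F p q)) $$ (a, c)"
    using linear_map_expansion[OF \<Lambda> _ ac, of "mat n n (\<lambda>(p, q). trace_last k F p q)"] by simp
  finally show ?thesis .
qed

subsection \<open>The rank-constrained problem\<close>

locale rank_problem =
  fixes n m k :: nat and X Y :: "complex mat" and \<Lambda> :: "complex mat \<Rightarrow> complex mat"
  assumes pos: "0 < n" "0 < m" "0 < k"
    and X: "X \<in> carrier_mat n n"
    and \<Lambda>: "herm_preserving_linear n m \<Lambda>"
    and Y: "Y \<in> carrier_mat m m"
begin

sublocale sym_hierarchy "n * k" m "constraint_coeff n k \<Lambda> Y"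
  by unfold_locales (use pos in simp)

abbreviation (input) d :: nat where "d \<equiv> n * k"

definition obj :: kernel where
  "obj r s = kron X (1\<^sub>m k) $$ (r, s)"

lemma map_carrier: "A \<in> carrier_mat n n \<Longrightarrow> \<Lambda> A \<in> carrier_mat m m"
  using \<Lambda> unfolding herm_preserving_linear_def by blast

lemma constraint_eq:
  assumes "I < m * b" "J < m * b"
  shows "constraint b F I J = Y $$ (I div b, J div b) * (\<Sum>r<d. F (r * b + I mod b) (r * b + J mod b))
     - \<Lambda> (mat n n (\<lambda>(p, q). trace_last k (\<lambda>r s. F (r * b + I mod b) (s * b + J mod b)) p q))
         $$ (I div b, J div b)"
  unfolding constraint_def
  using assms by (intro constraint_coeff_sum[OF \<Lambda> _ _ pos(3)]) (auto intro: less_mult_imp_div_less)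

lemma loewner_iff_constraint:
  assumes \<Phi>: "\<Phi> \<in> carrier_mat (d ^ Suc M) (d ^ Suc M)"
  shows "loewner_le (apply_first m d (d ^ M) (\<lambda>A. \<Lambda> (ptrace_second n k A)) \<Phi>) (kron Y (ptrace_first d (d ^ M) \<Phi>))
    \<longleftrightarrow> psd_kernel (m * d ^ M) (constraint (d ^ M) (kernel_of_mat \<Phi>))"
proof -
  let ?b = "d ^ M" and ?F = "kernel_of_mat \<Phi>"
  let ?A = "apply_first m d ?b (\<lambda>A. \<Lambda> (ptrace_second n k A)) \<Phi>"
  let ?B = "kron Y (ptrace_first d ?b \<Phi>)"
  have b: "0 < ?b" using pos by simp
  have dims: "?A \<in> carrier_mat (m * ?b) (m * ?b)" "?B \<in> carrier_mat (m * ?b) (m * ?b)"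
    using Y by (auto simp: apply_first_def kron_def ptrace_first_def)
  have F: "\<Phi> $$ (r * ?b + i, s * ?b + j) = ?F (r * ?b + i) (s * ?b + j)"
    if "r < d" "s < d" "i < ?b" "j < ?b" for r s i j
    using \<Phi> mult_add_less_mult[OF that(1,3)] mult_add_less_mult[OF that(2,4)]
    by (simp add: kernel_of_mat_def)
  have entry: "(?B - ?A) $$ (I, J) = constraint ?b ?F I J" if IJ: "I < m * ?b" "J < m * ?b" for I J
  proof -
    have md: "I mod ?b < ?b" "J mod ?b < ?b" using b by auto
    have "?B $$ (I, J) = Y $$ (I div ?b, J div ?b) * (\<Sum>r<d. ?F (r * ?b + I mod ?b) (r * ?b + J mod ?b))"
      using IJ Y md by (simp add: kron_def ptrace_first_def F)
    moreover have "ptrace_second n k (mat d d (\<lambda>(r, s). \<Phi> $$ (r * ?b + I mod ?b, s * ?b + J mod ?b)))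
       = mat n n (\<lambda>(p, q). trace_last k (\<lambda>r s. ?F (r * ?b + I mod ?b) (s * ?b + J mod ?b)) p q)"
      by (intro eq_matI)
         (auto simp: ptrace_second_def trace_last_def F md mult_add_less_mult intro!: sum.cong)
    then have "?A $$ (I, J) = \<Lambda> (mat n n (\<lambda>(p, q). trace_last k (\<lambda>r s. ?F (r * ?b + I mod ?b) (s * ?b + J mod ?b)) p q))
         $$ (I div ?b, J div ?b)"
      using IJ by (simp add: apply_first_def)
    ultimately show ?thesis
      unfolding constraint_eq[OF IJ] using dims IJ by simp
  qed
  have "loewner_le ?A ?B \<longleftrightarrow> psd (?B - ?A)"
    using dims unfolding loewner_le_def by auto
  also have "\<dots> \<longleftrightarrow> psd_kernel (m * ?b) (\<lambda>I J. (?B - ?A) $$ (I, J))"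
    using dims by (intro psd_iff_psd_kernel) auto
  also have "\<dots> \<longleftrightarrow> psd_kernel (m * ?b) (constraint ?b ?F)"
    by (rule psd_kernel_cong[OF entry])
  finally show ?thesis .
qed

lemma objective_eq:
  assumes \<Phi>: "\<Phi> \<in> carrier_mat (d ^ Suc M) (d ^ Suc M)"
  shows "Re (mtrace (kron (kron X (1\<^sub>m k)) (1\<^sub>m (d ^ M)) * \<Phi>))
     = kernel_value obj ((trace_last d ^^ M) (kernel_of_mat \<Phi>))"
proof -
  let ?W = "kron X (1\<^sub>m k)" and ?b = "d ^ M"
  have W: "?W \<in> carrier_mat d d" by (intro kron_carrier X one_carrier_mat)
  have K: "kron ?W (1\<^sub>m ?b) \<in> carrier_mat (d * ?b) (d * ?b)" by (intro kron_carrier W one_carrier_mat)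
  have \<Phi>': "\<Phi> \<in> carrier_mat (d * ?b) (d * ?b)" using \<Phi> by (simp add: mult_ac)
  have "mtrace (kron ?W (1\<^sub>m ?b) * \<Phi>)
      = (\<Sum>I<d * ?b. \<Sum>J<d * ?b. kron ?W (1\<^sub>m ?b) $$ (I, J) * kernel_of_mat \<Phi> J I)"
    unfolding mtrace_mult[OF K \<Phi>'] using \<Phi>' by (intro sum.cong refl) (simp add: kernel_of_mat_def)
  also have "\<dots> = (\<Sum>r<d. \<Sum>s<d. ?W $$ (r, s) * (trace_last d ^^ M) (kernel_of_mat \<Phi>) s r)"
    unfolding trace_last_funpow by (rule kron_one_sum[OF W]) (use pos in simp)
  finally show ?thesis unfolding kernel_value_def obj_def by simp
qed

text \<open>The objective and the trace depend only on the one-party marginal, so the hierarchy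
  becomes the maximization of one function over decreasing sets. \<open>Suc M\<close> parties
  correspond to \<open>marginals M\<close>.\<close>

lemma xi_N_eq:
  "xi_N n m k X \<Lambda> Y (Suc M) = Sup {ereal (kernel_value obj \<sigma>) | \<sigma>. \<sigma> \<in> marginals M \<and> ktrace d \<sigma> = 1}"
proof -
  let ?D = "d ^ Suc M"
  let ?feas = "\<lambda>\<Phi>. \<Phi> \<in> carrier_mat ?D ?D \<and> psd \<Phi> \<and> mtrace \<Phi> = 1 \<and>
    sym_proj (Suc M) d * \<Phi> * sym_proj (Suc M) d = \<Phi> \<and>
    loewner_le (apply_first m d (d ^ M) (\<lambda>A. \<Lambda> (ptrace_second n k A)) \<Phi>) (kron Y (ptrace_first d (d ^ M) \<Phi>))"
  have feas: "?feas \<Phi> \<longleftrightarrow> kernel_of_mat \<Phi> \<in> feasible M \<and> ktrace ?D (kernel_of_mat \<Phi>) = 1"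
    if \<Phi>: "\<Phi> \<in> carrier_mat ?D ?D" for \<Phi>
  proof -
    have "supported ?D (kernel_of_mat \<Phi>)"
      using \<Phi> by (auto simp: supported_def kernel_of_mat_def simp del: power_Suc)
    moreover have "symmetric_kernel (Suc M) d (\<lambda>i j. \<Phi> $$ (i, j)) \<longleftrightarrow> symmetric_kernel (Suc M) d (kernel_of_mat \<Phi>)"
      using \<Phi> by (simp add: symmetric_kernel_def kernel_of_mat_def del: power_Suc)
    ultimately show ?thesis
      using \<Phi> unfolding feasible_def mem_Collect_eq loewner_iff_constraint[OF \<Phi>]
        sym_proj_sandwich_iff[OF d_pos \<Phi>] psd_kernel_of_mat[OF \<Phi>] mtrace_eq_ktrace[OF \<Phi>] by blast
  qed
  have "{ereal (Re (mtrace (kron (kron X (1\<^sub>m k)) (1\<^sub>m (d ^ M)) * \<Phi>))) | \<Phi>. ?feas \<Phi>}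
     = {ereal (kernel_value obj \<sigma>) | \<sigma>. \<sigma> \<in> marginals M \<and> ktrace d \<sigma> = 1}" (is "?A = ?B")
  proof (intro equalityI subsetI)
    fix x assume "x \<in> ?A"
    then obtain \<Phi> where x: "x = ereal (Re (mtrace (kron (kron X (1\<^sub>m k)) (1\<^sub>m (d ^ M)) * \<Phi>)))" and f: "?feas \<Phi>"
      by blast
    then have \<Phi>: "\<Phi> \<in> carrier_mat ?D ?D" by blast
    have F: "kernel_of_mat \<Phi> \<in> feasible M" "ktrace ?D (kernel_of_mat \<Phi>) = 1"
      using f feas[OF \<Phi>] by blast+
    have "ktrace d ((trace_last d ^^ M) (kernel_of_mat \<Phi>)) = 1"
      unfolding ktrace_trace_last_funpow by (rule F(2))
    then show "x \<in> ?B"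
      unfolding x objective_eq[OF \<Phi>] marginals_def using F(1) by blast
  next
    fix x assume "x \<in> ?B"
    then obtain F where x: "x = ereal (kernel_value obj ((trace_last d ^^ M) F))"
      and F: "F \<in> feasible M" "ktrace d ((trace_last d ^^ M) F) = 1"
      unfolding marginals_def by blast
    define \<Phi> where "\<Phi> = mat ?D ?D (\<lambda>(i, j). F i j)"
    have \<Phi>: "\<Phi> \<in> carrier_mat ?D ?D" by (simp add: \<Phi>_def)
    have ker: "kernel_of_mat \<Phi> = F"
      unfolding \<Phi>_def by (rule kernel_of_mat_mat[OF feasibleD(1)[OF F(1)]])
    have "?feas \<Phi>" unfolding feas[OF \<Phi>] ker using F ktrace_trace_last_funpow by simp
    moreover have "x = ereal (Re (mtrace (kron (kron X (1\<^sub>m k)) (1\<^sub>m (d ^ M)) * \<Phi>)))"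
      unfolding x objective_eq[OF \<Phi>] ker ..
    ultimately show "x \<in> ?A" by blast
  qed
  then show ?thesis unfolding xi_N_def Let_def by simp
qed

section \<open>Reduction from the extended system to the original one\<close>

definition reduced :: "kernel \<Rightarrow> complex mat" where
  "reduced \<sigma> = mat n n (\<lambda>(p, q). trace_last k \<sigma> p q)"

lemma reduced_carrier: "reduced \<sigma> \<in> carrier_mat n n"
  by (simp add: reduced_def)

lemma mtrace_reduced: "mtrace (reduced \<sigma>) = ktrace d \<sigma>"
  unfolding ktrace_trace_last[symmetric] by (simp add: mtrace_def ktrace_def reduced_def)

lemma psd_reduced:
  assumes "psd_kernel d \<sigma>"
  shows "psd (reduced \<sigma>)"
  unfolding psd_iff_psd_kernel[OF reduced_carrier]
  using psd_kernel_trace_last[OF assms] by (subst psd_kernel_cong) (auto simp: reduced_def)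

lemma reduced_value: "Re (mtrace (X * reduced \<sigma>)) = kernel_value obj \<sigma>"
proof -
  have "mtrace (X * reduced \<sigma>) = (\<Sum>p<n. \<Sum>q<n. X $$ (p, q) * trace_last k \<sigma> q p)"
    unfolding mtrace_mult[OF X reduced_carrier] by (intro sum.cong refl) (simp add: reduced_def)
  also have "\<dots> = (\<Sum>r<d. \<Sum>s<d. kron X (1\<^sub>m k) $$ (r, s) * \<sigma> s r)"
    unfolding trace_last_def by (rule kron_one_sum[OF X pos(3), symmetric])
  finally show ?thesis unfolding kernel_value_def obj_def by simp
qed

lemma loewner_reduced_iff:
  assumes "ktrace d \<sigma> = 1"
  shows "loewner_le (\<Lambda> (reduced \<sigma>)) Y \<longleftrightarrow> psd_kernel m (constraint 1 \<sigma>)"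
proof -
  have L: "\<Lambda> (reduced \<sigma>) \<in> carrier_mat m m" by (rule map_carrier[OF reduced_carrier])
  have "(Y - \<Lambda> (reduced \<sigma>)) $$ (a, c) = constraint 1 \<sigma> a c" if "a < m" "c < m" for a c
    using constraint_eq[of a 1 c \<sigma>] that assms L Y by (simp add: ktrace_def reduced_def)
  then have "psd_kernel m (\<lambda>a c. (Y - \<Lambda> (reduced \<sigma>)) $$ (a, c)) \<longleftrightarrow> psd_kernel m (constraint 1 \<sigma>)"
    by (rule psd_kernel_cong)
  then show ?thesis
    using psd_iff_psd_kernel[OF minus_carrier_mat[OF L, of Y]] L Y unfolding loewner_le_def by auto
qed

text \<open>A feasible \<rho> has a purification, whose tensor power is feasible at every level and
  has the same value.\<close>

lemma xi_le_xi_N: "xi n k X \<Lambda> Y \<le> xi_N n m k X \<Lambda> Y (Suc M)"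
  unfolding xi_def xi_N_eq
proof (rule Sup_mono, elim CollectE exE conjE)
  fix x \<rho>
  assume x: "x = ereal (Re (mtrace (X * \<rho>)))" and \<rho>: "\<rho> \<in> carrier_mat n n" "loewner_le (\<Lambda> \<rho>) Y"
    "mtrace \<rho> = 1" "psd \<rho>" "crank \<rho> \<le> k"
  obtain a where a: "\<And>i j. i < n \<Longrightarrow> j < n \<Longrightarrow> \<rho> $$ (i, j) = (\<Sum>l<k. a l i * cnj (a l j))"
    using psd_kernel_gram_of_crank[OF \<rho>(1) _ \<rho>(5)] \<rho>(4) psd_iff_psd_kernel[OF \<rho>(1)] by blast
  \<comment> \<open>The purification: the \<open>l\<close>-th Gram vector is placed at ancilla index
    \<open>l\<close>, so that tracing out the ancilla restores \<rho>.\<close>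
  define \<phi> where "\<phi> r = a (r mod k) (r div k)" for r
  let ?\<sigma> = "\<lambda>r s. \<phi> r * cnj (\<phi> s)"
  have red: "reduced ?\<sigma> = \<rho>"
    using \<rho>(1) a by (intro eq_matI) (auto simp: reduced_def trace_last_def \<phi>_def)
  have tr: "ktrace d ?\<sigma> = 1" using mtrace_reduced[of ?\<sigma>] red \<rho>(3) by simp
  have "psd_kernel m (constraint 1 ?\<sigma>)" using loewner_reduced_iff[OF tr] red \<rho>(2) by simp
  then have feas: "pure_kernel M \<phi> \<in> feasible M" by (rule pure_kernel_feasible)
  have T: "(trace_last d ^^ M) (pure_kernel M \<phi>) = pure_kernel 0 \<phi>"
    using tr by (intro trace_last_funpow_pure_kernel) (simp add: ktrace_def)
  have "pure_kernel 0 \<phi> \<in> marginals M" unfolding marginals_def T[symmetric] using feas by blast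
  moreover have "ktrace d (pure_kernel 0 \<phi>) = 1"
    using tr by (simp add: ktrace_def pure_kernel_0)
  moreover have "kernel_value obj (pure_kernel 0 \<phi>) = Re (mtrace (X * \<rho>))"
    unfolding red[symmetric] reduced_value by (simp add: kernel_value_def pure_kernel_0)
  ultimately show "\<exists>y\<in>{ereal (kernel_value obj \<sigma>) | \<sigma>. \<sigma> \<in> marginals M \<and> ktrace d \<sigma> = 1}. x \<le> y"
    unfolding x by (intro bexI[of _ "ereal (kernel_value obj (pure_kernel 0 \<phi>))"] CollectI exI conjI refl) simp_all
qed

lemma xi_N_decreasing: "xi_N n m k X \<Lambda> Y (Suc (Suc M)) \<le> xi_N n m k X \<Lambda> Y (Suc M)"
  unfolding xi_N_eq using marginals_Suc_subset[of M] by (intro Sup_subset_mono) blast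

text \<open>Tracing the ancilla out of a product of \<open>u\<close> and \<open>v\<close> leaves
  \<open>k\<close> rank-one summands, one per ancilla basis vector; this is the rank bound.\<close>

lemma product_state_le_xi:
  assumes "\<sigma> \<in> limit_states" "\<And>i j. i < d \<Longrightarrow> j < d \<Longrightarrow> \<sigma> i j = u i * v j"
  shows "ereal (kernel_value obj \<sigma>) \<le> xi n k X \<Lambda> Y"
proof -
  have \<sigma>: "\<sigma> \<in> feasible 0" "ktrace d \<sigma> = 1"
    using assms(1) limit_marginals_feasible unfolding limit_states_def by auto
  have "psd (reduced \<sigma>)" using feasibleD(2)[OF \<sigma>(1)] by (intro psd_reduced) simp
  moreover have "mtrace (reduced \<sigma>) = 1" using mtrace_reduced \<sigma>(2) by simp
  moreover have "loewner_le (\<Lambda> (reduced \<sigma>)) Y"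
    using loewner_reduced_iff[OF \<sigma>(2)] feasibleD(4)[OF \<sigma>(1)] by simp
  moreover have "crank (reduced \<sigma>) \<le> k"
  proof (rule crank_le_of_factorization[OF reduced_carrier])
    fix i j assume "i < n" "j < n"
    then show "reduced \<sigma> $$ (i, j) = (\<Sum>l<k. u (i * k + l) * v (j * k + l))"
      using assms(2) by (simp add: reduced_def trace_last_def mult_add_less_mult)
  qed
  ultimately show ?thesis
    unfolding xi_def reduced_value[symmetric] using reduced_carrier by (intro Sup_upper) blast
qed

text \<open>A number below the infimum is exceeded at every level. Compactness turns the witnesses
  into a limit state, and an optimal limit state of rank one is feasible for the original
  problem.\<close>

lemma Inf_xi_N_le_xi: "(INF M. xi_N n m k X \<Lambda> Y (Suc M)) \<le> xi n k X \<Lambda> Y"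
proof (rule dense_le)
  fix c assume c: "c < (INF M. xi_N n m k X \<Lambda> Y (Suc M))"
  show "c \<le> xi n k X \<Lambda> Y"
  proof (cases "c = - \<infinity>")
    case False
    have "\<exists>\<sigma>. \<sigma> \<in> marginals M \<and> ktrace d \<sigma> = 1 \<and> c < ereal (kernel_value obj \<sigma>)" for M
    proof -
      have "c < xi_N n m k X \<Lambda> Y (Suc M)" using c by (meson INF_lower UNIV_I order_less_le_trans)
      then show ?thesis unfolding xi_N_eq less_Sup_iff by blast
    qed
    then obtain x where x: "\<And>M. x M \<in> marginals M" "\<And>M. ktrace d (x M) = 1"
      "\<And>M. c < ereal (kernel_value obj (x M))" by metis
    \<comment> \<open>The number is real: it lies below a real value, and minus infinity has been
      excluded.\<close>
    obtain c' where c': "c = ereal c'"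
      using False x(3)[of 0] by (cases c) auto
    have "closed {\<sigma>. c' \<le> kernel_value obj \<sigma>}"
      by (intro closed_Collect_le continuous_on_const continuous_on_kernel_value)
    then obtain \<sigma>0 where \<sigma>0: "\<sigma>0 \<in> limit_states" "c' \<le> kernel_value obj \<sigma>0"
      using exists_limit_state[OF x(1,2), of "{\<sigma>. c' \<le> kernel_value obj \<sigma>}"] x(3) c'
      by (auto simp: less_imp_le)
    then have "limit_states \<noteq> {}" by blast
    then obtain \<sigma> u v where \<sigma>: "\<sigma> \<in> limit_states"
      "\<And>\<tau>. \<tau> \<in> limit_states \<Longrightarrow> kernel_value obj \<tau> \<le> kernel_value obj \<sigma>"
      "\<And>i j. i < d \<Longrightarrow> j < d \<Longrightarrow> \<sigma> i j = u i * v j"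
      using pure_optimal_limit_state[of obj] by blast
    have "c \<le> ereal (kernel_value obj \<sigma>)" using \<sigma>(2)[OF \<sigma>0(1)] \<sigma>0(2) c' by simp
    also have "\<dots> \<le> xi n k X \<Lambda> Y" by (rule product_state_le_xi[OF \<sigma>(1,3)])
    finally show ?thesis .
  qed simp
qed

lemma xi_N_tendsto: "(\<lambda>N. xi_N n m k X \<Lambda> Y N) \<longlonglongrightarrow> xi n k X \<Lambda> Y"
proof -
  have "decseq (\<lambda>M. xi_N n m k X \<Lambda> Y (Suc M))"
    by (rule decseq_SucI) (rule xi_N_decreasing)
  then have "(\<lambda>M. xi_N n m k X \<Lambda> Y (Suc M)) \<longlonglongrightarrow> (INF M. xi_N n m k X \<Lambda> Y (Suc M))"
    by (rule LIMSEQ_INF)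
  moreover have "(INF M. xi_N n m k X \<Lambda> Y (Suc M)) = xi n k X \<Lambda> Y"
    by (intro antisym Inf_xi_N_le_xi INF_greatest xi_le_xi_N)
  ultimately have "(\<lambda>M. xi_N n m k X \<Lambda> Y (Suc M)) \<longlonglongrightarrow> xi n k X \<Lambda> Y" by simp
  \<comment> \<open>The limit is insensitive to the term at \<open>N = 0\<close>, where there is no
    party.\<close>
  then show ?thesis by (rule LIMSEQ_imp_Suc)
qed

end

theorem theorem5:
  fixes n m k :: nat and X Y :: "complex mat" and \<Lambda> :: "complex mat \<Rightarrow> complex mat"
  assumes "0 < n" "0 < m" "0 < k"
    and "X \<in> carrier_mat n n" "herm X"
    and "herm_preserving_linear n m \<Lambda>"
    and "Y \<in> carrier_mat m m" "herm Y"
  shows "(\<forall>N\<ge>1. xi n k X \<Lambda> Y \<le> xi_N n m k X \<Lambda> Y N)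
    \<and> (\<forall>N\<ge>1. xi_N n m k X \<Lambda> Y (N + 1) \<le> xi_N n m k X \<Lambda> Y N)
    \<and> (\<lambda>N. xi_N n m k X \<Lambda> Y N) \<longlonglongrightarrow> xi n k X \<Lambda> Y"
proof -
  interpret rank_problem n m k X Y \<Lambda>
    using assms by unfold_locales
  have "xi n k X \<Lambda> Y \<le> xi_N n m k X \<Lambda> Y N \<and> xi_N n m k X \<Lambda> Y (N + 1) \<le> xi_N n m k X \<Lambda> Y N"
    if "1 \<le> N" for N
  proof -
    obtain M where "N = Suc M" using \<open>1 \<le> N\<close> by (cases N) auto
    then show ?thesis using xi_le_xi_N xi_N_decreasing by simp
  qed
  then show ?thesis using xi_N_tendsto by blast
qed

end
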